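(* Let $A$ be a Hopf algebra and $B\subseteq A$ a quantum homogeneous $A$-space such that $\pi_B(A)$ is a cosemisimple Hopf algebra and $A$ has no zero divisors. If $\Omega^\bullet(B)$ is a left $A$-covariant $*$-differential calculus over $B$, then $\Omega^1(B)$ admits a left $A$-covariant torsion-free connection.
   Context: All algebras are unital over $\mathbb{C}$; all Hopf algebras have bijective antipode. A left coideal subalgebra $B\subseteq A$ (i.e. $\Delta(B)\subseteq A\otimes B$) is a quantum homogeneous $A$-space if $A$ is faithfully flat as a right $B$-module and $B^+A=AB^+$, where $B^+=\ker(\varepsilon|_B)$; put $\pi_B(A):=A/B^+A$. A differential calculus over $B$ is a differential graded algebra $(\Omega^\bullet=\bigoplus_{k\ge0}\Omega^k,\mathrm{d})$ with $\Omega^0=B$, generated as an algebra by the elements $b,\mathrm{d}b'$ for $b,b'\in B$; its product is written $\wedge$. It is left $A$-covariant if there is a coaction $\Delta_L:\Omega^\bullet\to A\otimes\Omega^\bullet$ making $\Omega^\bullet$ a left $A$-comodule algebra and $\mathrm{d}$ a left $A$-comodule map. It is a $*$-differential calculus over a $*$-algebra $B$ if the $*$-map of $B$ extends to a conjugate-linear involution of $\Omega^\bullet$ with $\mathrm{d}(\omega^* )=(\mathrm{d}\omega)^*$ and $(\omega\wedge\nu)^*=(-1)^{kl}\nu^*\wedge\omega^*$ for $\omega\in\Omega^k,\nu\in\Omega^l$. A connection on $\Omega^1(B)$ is a $\mathbb{C}$-linear map $\nabla:\Omega^1(B)\to\Omega^1(B)\otimes_B\Omega^1(B)$ with $\nabla(b\omega)=\mathrm{d}b\otimes\omega+b\nabla(\omega)$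 for $b\in B$, $\omega\in\Omega^1(B)$; it is left $A$-covariant if it is a left $A$-comodule map. Its torsion is $T_\nabla:=\wedge\circ\nabla-\mathrm{d}:\Omega^1(B)\to\Omega^2(B)$, and $\nabla$ is torsion-free if $T_\nabla=0$. *)

theory Defs
  imports Complex_Main "HOL-Library.Poly_Mapping"
begin

section \<open>Complex vector spaces and algebras\<close>

class complex_vector = ab_group_add +
  fixes scaleC :: "complex \<Rightarrow> 'a \<Rightarrow> 'a" (infixr "*\<^sub>C" 75)
  assumes scaleC_add_right: "c *\<^sub>C (x + y) = c *\<^sub>C x + c *\<^sub>C y"
    and scaleC_add_left: "(c + e) *\<^sub>C x = c *\<^sub>C x + e *\<^sub>C x"
    and scaleC_scaleC: "c *\<^sub>C e *\<^sub>C x = (c * e) *\<^sub>C x"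
    and scaleC_one: "1 *\<^sub>C x = x"

class complex_algebra_1 = complex_vector + ring_1 +
  assumes mult_scaleC_left: "(c *\<^sub>C x) * y = c *\<^sub>C (x * y)"
    and mult_scaleC_right: "x * (c *\<^sub>C y) = c *\<^sub>C (x * y)"

global_interpretation cvec: vector_space "scaleC :: complex \<Rightarrow> 'a \<Rightarrow> 'a::complex_vector"
  by standard (simp_all add: scaleC_add_right scaleC_add_left scaleC_scaleC scaleC_one)

global_interpretation cvec_pair: vector_space_pair
  "scaleC :: complex \<Rightarrow> 'a \<Rightarrow> 'a::complex_vector"
  "scaleC :: complex \<Rightarrow> 'b \<Rightarrow> 'b::complex_vector"
  by unfold_locales

abbreviation clinear :: "('a::complex_vector \<Rightarrow> 'b::complex_vector) \<Rightarrow> bool"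
  where "clinear \<equiv> Vector_Spaces.linear scaleC scaleC"

abbreviation csubspace :: "'a::complex_vector set \<Rightarrow> bool"
  where "csubspace \<equiv> cvec.subspace"

abbreviation cspan :: "'a::complex_vector set \<Rightarrow> 'a set"
  where "cspan \<equiv> cvec.span"

definition cbilinear ::
  "('a::complex_vector \<Rightarrow> 'b::complex_vector \<Rightarrow> 'c::complex_vector) \<Rightarrow> bool"
  where "cbilinear f \<longleftrightarrow> (\<forall>x. clinear (f x)) \<and> (\<forall>y. clinear (\<lambda>x. f x y))"

lemma clinearI:
  "(\<And>x y. f (x + y) = f x + f y) \<Longrightarrow> (\<And>c x. f (c *\<^sub>C x) = c *\<^sub>C f x) \<Longrightarrow> clinear f"
  by unfold_locales auto

instantiation complex :: complex_vector
begin
definition "scaleC = ((*) :: complex \<Rightarrow> complex \<Rightarrow> complex)"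
instance by standard (simp_all add: scaleC_complex_def algebra_simps)
end

instantiation poly_mapping :: (type, complex_vector) complex_vector
begin
lift_definition scaleC_poly_mapping ::
  "complex \<Rightarrow> ('a \<Rightarrow>\<^sub>0 'b) \<Rightarrow> 'a \<Rightarrow>\<^sub>0 'b" is "\<lambda>c f k. c *\<^sub>C f k"
  by (erule finite_subset[rotated]) auto
instance
  by standard (transfer; simp add: fun_eq_iff scaleC_add_right scaleC_add_left
      scaleC_scaleC scaleC_one)+
end


section \<open>Tensor products over the complex numbers\<close>

abbreviation pair_gen :: "'a \<Rightarrow> 'b \<Rightarrow> ('a \<times> 'b) \<Rightarrow>\<^sub>0 complex"
  where "pair_gen x y \<equiv> Poly_Mapping.single (x, y) 1"

definition bilin_rels :: "(('a::complex_vector \<times> 'b::complex_vector) \<Rightarrow>\<^sub>0 complex) set" where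
  "bilin_rels =
     {pair_gen (x + x') y - pair_gen x y - pair_gen x' y | x x' y. True} \<union>
     {pair_gen x (y + y') - pair_gen x y - pair_gen x y' | x y y'. True} \<union>
     {pair_gen (c *\<^sub>C x) y - c *\<^sub>C pair_gen x y | c x y. True} \<union>
     {pair_gen x (c *\<^sub>C y) - c *\<^sub>C pair_gen x y | c x y. True}"

lemma cspan_rel:
  "x - x \<in> cspan K"
  "x - y \<in> cspan K \<Longrightarrow> y - x \<in> cspan K"
  "x - y \<in> cspan K \<Longrightarrow> y - z \<in> cspan K \<Longrightarrow> x - z \<in> cspan K"
  "x - x' \<in> cspan K \<Longrightarrow> y - y' \<in> cspan K \<Longrightarrow> (x + y) - (x' + y') \<in> cspan K"
  "x - x' \<in> cspan K \<Longrightarrow> y - y' \<in> cspan K \<Longrightarrow> (x - y) - (x' - y') \<in> cspan K"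
  "x - y \<in> cspan K \<Longrightarrow> - x - - y \<in> cspan K"
  "x - y \<in> cspan K \<Longrightarrow> c *\<^sub>C x - c *\<^sub>C y \<in> cspan K"
proof -
  show "x - x \<in> cspan K"
    by (simp add: cvec.span_zero)
  show "y - x \<in> cspan K" if "x - y \<in> cspan K"
    using cvec.span_neg[OF that] by simp
  show "x - z \<in> cspan K" if "x - y \<in> cspan K" "y - z \<in> cspan K"
    using cvec.span_add[OF that] by simp
  show "(x + y) - (x' + y') \<in> cspan K" if "x - x' \<in> cspan K" "y - y' \<in> cspan K"
    using cvec.span_add[OF that] by (simp add: algebra_simps)
  show "(x - y) - (x' - y') \<in> cspan K" if "x - x' \<in> cspan K" "y - y' \<in> cspan K"
    using cvec.span_diff[OF that] by (simp add: algebra_simps)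
  show "- x - - y \<in> cspan K" if "x - y \<in> cspan K"
    using cvec.span_neg[OF that] by simp
  show "c *\<^sub>C x - c *\<^sub>C y \<in> cspan K" if "x - y \<in> cspan K"
    using cvec.span_scale[OF that, of c] by (simp add: cvec.scale_right_diff_distrib)
qed

quotient_type (overloaded) ('a, 'b) tensor (infixr "\<otimes>" 21) =
  "(('a::complex_vector \<times> 'b::complex_vector) \<Rightarrow>\<^sub>0 complex)" / "\<lambda>s t. s - t \<in> cspan bilin_rels"
  by (intro equivpI reflpI sympI transpI) (fact cspan_rel)+

instantiation tensor :: (complex_vector, complex_vector) complex_vector
begin
lift_definition zero_tensor :: "'a \<otimes> 'b" is 0 .
lift_definition plus_tensor :: "'a \<otimes> 'b \<Rightarrow> 'a \<otimes> 'b \<Rightarrow> 'a \<otimes> 'b" is "(+)"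
  by (fact cspan_rel(4))
lift_definition minus_tensor :: "'a \<otimes> 'b \<Rightarrow> 'a \<otimes> 'b \<Rightarrow> 'a \<otimes> 'b" is "(-)"
  by (fact cspan_rel(5))
lift_definition uminus_tensor :: "'a \<otimes> 'b \<Rightarrow> 'a \<otimes> 'b" is "uminus"
  by (fact cspan_rel(6))
lift_definition scaleC_tensor :: "complex \<Rightarrow> 'a \<otimes> 'b \<Rightarrow> 'a \<otimes> 'b" is scaleC
  by (fact cspan_rel(7))
instance
  by standard (transfer; simp add: cvec.span_zero algebra_simps scaleC_add_right scaleC_add_left
      scaleC_scaleC scaleC_one)+
end

lift_definition tens :: "'a::complex_vector \<Rightarrow> 'b::complex_vector \<Rightarrow> 'a \<otimes> 'b" (infixl "\<otimes>" 70)
  is "\<lambda>x y. pair_gen x y" .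

text \<open>The linear map out of the tensor product induced by a bilinear map; see the
  characterisation \<open>tlift_tens\<close> below. It is only meaningful for bilinear arguments.\<close>

definition free_ext ::
  "('a \<Rightarrow> 'b \<Rightarrow> 'c::complex_vector) \<Rightarrow> (('a \<times> 'b) \<Rightarrow>\<^sub>0 complex) \<Rightarrow> 'c" where
  "free_ext \<beta> s = (\<Sum>p\<in>Poly_Mapping.keys s. Poly_Mapping.lookup s p *\<^sub>C \<beta> (fst p) (snd p))"

definition tlift ::
  "('a::complex_vector \<Rightarrow> 'b::complex_vector \<Rightarrow> 'c::complex_vector) \<Rightarrow> 'a \<otimes> 'b \<Rightarrow> 'c" where
  "tlift \<beta> t = free_ext \<beta> (rep_tensor t)"

definition tmap :: "('a::complex_vector \<Rightarrow> 'c::complex_vector) \<Rightarrow>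
    ('b::complex_vector \<Rightarrow> 'd::complex_vector) \<Rightarrow> 'a \<otimes> 'b \<Rightarrow> 'c \<otimes> 'd" where
  "tmap f g = tlift (\<lambda>x y. f x \<otimes> g y)"

definition tassoc :: "('a::complex_vector \<otimes> 'b::complex_vector) \<otimes> 'c::complex_vector
    \<Rightarrow> 'a \<otimes> ('b \<otimes> 'c)" where
  "tassoc = tlift (\<lambda>t z. tlift (\<lambda>x y. x \<otimes> (y \<otimes> z)) t)"

definition tmult :: "('a::complex_vector \<Rightarrow> 'a \<Rightarrow> 'a) \<Rightarrow> ('b::complex_vector \<Rightarrow> 'b \<Rightarrow> 'b)
    \<Rightarrow> 'a \<otimes> 'b \<Rightarrow> 'a \<otimes> 'b \<Rightarrow> 'a \<otimes> 'b" where
  "tmult m n s t = tlift (\<lambda>x y. tlift (\<lambda>x' y'. m x x' \<otimes> n y y') t) s"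

text \<open>For subspaces, \<open>tsub V W\<close> is the image of the (injective) map from the tensor product
  of \<open>V\<close> and \<open>W\<close> to that of the ambient spaces.\<close>

definition tsub :: "'a::complex_vector set \<Rightarrow> 'b::complex_vector set \<Rightarrow> ('a \<otimes> 'b) set" where
  "tsub V W = cspan {x \<otimes> y | x y. x \<in> V \<and> y \<in> W}"

lemma free_ext_superset:
  assumes "finite X" "Poly_Mapping.keys s \<subseteq> X"
  shows "free_ext \<beta> s = (\<Sum>p\<in>X. Poly_Mapping.lookup s p *\<^sub>C \<beta> (fst p) (snd p))"
  unfolding free_ext_def using assms
  by (intro sum.mono_neutral_left) (auto simp: in_keys_iff)

lemma clinear_free_ext: "clinear (free_ext \<beta>)"
proof (rule clinearI)
  fix s t :: "('a \<times> 'b) \<Rightarrow>\<^sub>0 complex" and c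
  let ?X = "Poly_Mapping.keys s \<union> Poly_Mapping.keys t"
  have k: "Poly_Mapping.keys (s + t) \<subseteq> ?X"
    by (rule Poly_Mapping.keys_add)
  show "free_ext \<beta> (s + t) = free_ext \<beta> s + free_ext \<beta> t"
    using k by (simp add: free_ext_superset[of ?X] lookup_add scaleC_add_left sum.distrib)
  have k': "Poly_Mapping.keys (c *\<^sub>C s) \<subseteq> Poly_Mapping.keys s"
    by (auto simp: in_keys_iff scaleC_poly_mapping.rep_eq)
  show "free_ext \<beta> (c *\<^sub>C s) = c *\<^sub>C free_ext \<beta> s"
    using k' by (simp add: free_ext_superset[of "Poly_Mapping.keys s"]
        scaleC_poly_mapping.rep_eq scaleC_complex_def cvec.scale_sum_right scaleC_scaleC)
qed

lemma free_ext_single: "free_ext \<beta> (pair_gen x y) = \<beta> x y"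
  by (simp add: free_ext_def scaleC_one)

lemma free_ext_bilin_rels:
  assumes "cbilinear \<beta>" "s \<in> cspan bilin_rels"
  shows "free_ext \<beta> s = 0"
proof -
  interpret F: Vector_Spaces.linear scaleC scaleC "free_ext \<beta>" by (rule clinear_free_ext)
  have l: "clinear (\<beta> x)" "clinear (\<lambda>x. \<beta> x y)" for x y
    using assms(1) by (auto simp: cbilinear_def)
  have "free_ext \<beta> r = 0" if "r \<in> bilin_rels" for r
    using that unfolding bilin_rels_def
    by (auto simp: F.diff F.scale free_ext_single cvec_pair.linear_add[OF l(1)]
        cvec_pair.linear_add[OF l(2)] cvec_pair.linear_scale[OF l(1)] cvec_pair.linear_scale[OF l(2)])
  then show ?thesis
    using F.eq_0_on_span[of bilin_rels s] assms(2) by blast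
qed

lemma tlift_abs:
  assumes "cbilinear \<beta>"
  shows "tlift \<beta> (abs_tensor s) = free_ext \<beta> s"
proof -
  interpret F: Vector_Spaces.linear scaleC scaleC "free_ext \<beta>" by (rule clinear_free_ext)
  have "rep_tensor (abs_tensor s) - s \<in> cspan bilin_rels"
    using Quotient3_rep_abs[OF Quotient3_tensor] by (simp add: cvec.span_zero)
  then show ?thesis
    using free_ext_bilin_rels[OF assms] F.diff by (fastforce simp: tlift_def)
qed

lemma tlift_tens: "cbilinear \<beta> \<Longrightarrow> tlift \<beta> (x \<otimes> y) = \<beta> x y"
  by (simp add: tens.abs_eq tlift_abs free_ext_single)

lemma clinear_tlift:
  assumes "cbilinear \<beta>"
  shows "clinear (tlift \<beta>)"
proof (rule clinearI)
  interpret F: Vector_Spaces.linear scaleC scaleC "free_ext \<beta>" by (rule clinear_free_ext)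
  show "tlift \<beta> (s + t) = tlift \<beta> s + tlift \<beta> t" for s t
    by (induct s, induct t) (simp add: plus_tensor.abs_eq tlift_abs[OF assms] F.add)
  show "tlift \<beta> (c *\<^sub>C s) = c *\<^sub>C tlift \<beta> s" for c s
    by (induct s) (simp add: scaleC_tensor.abs_eq tlift_abs[OF assms] F.scale)
qed

lemma cbilinear_tens: "cbilinear (\<otimes>)"
  unfolding cbilinear_def
proof (intro conjI allI; rule clinearI)
  note b = cvec.span_base[of _ bilin_rels]
  show "x \<otimes> (y + y') = x \<otimes> y + x \<otimes> y'" for x :: 'a and y y' :: 'b
    by (transfer, rule b, unfold bilin_rels_def diff_diff_eq[symmetric]) blast
  show "(x + x') \<otimes> y = x \<otimes> y + x' \<otimes> y" for x x' :: 'a and y :: 'b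
    by (transfer, rule b, unfold bilin_rels_def diff_diff_eq[symmetric]) blast
  show "x \<otimes> (c *\<^sub>C y) = c *\<^sub>C (x \<otimes> y)" for x :: 'a and c and y :: 'b
    by (transfer, rule b, unfold bilin_rels_def) blast
  show "(c *\<^sub>C x) \<otimes> y = c *\<^sub>C (x \<otimes> y)" for x :: 'a and c and y :: 'b
    by (transfer, rule b, unfold bilin_rels_def) blast
qed


section \<open>Quotient vector spaces\<close>

text \<open>A type cannot depend on the subspace one divides by, so one type holds all quotients of
  \<open>'v\<close> at once: it is the direct product of the spaces \<open>'v / cspan K\<close> over all sets \<open>K\<close>.
  The class of \<open>x\<close> modulo \<open>K\<close> is the element \<open>qproj K x\<close> of the factor at \<open>K\<close>
  (see \<open>qproj_eq_iff\<close> and \<open>clinear_qproj\<close>), and the quotient of a subspace \<open>V\<close> by \<open>K\<close> is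
  \<open>qproj K ` V\<close>.\<close>

quotient_type (overloaded) 'v quot = "'v::complex_vector set \<Rightarrow> 'v" / "\<lambda>f g. \<forall>K. f K - g K \<in> cspan K"
  by (intro equivpI reflpI sympI transpI) (use cspan_rel in blast)+

instantiation quot :: (complex_vector) complex_vector
begin
lift_definition zero_quot :: "'a quot" is "\<lambda>K. 0" .
lift_definition plus_quot :: "'a quot \<Rightarrow> 'a quot \<Rightarrow> 'a quot" is "\<lambda>f g K. f K + g K"
  by (use cspan_rel(4) in blast)
lift_definition minus_quot :: "'a quot \<Rightarrow> 'a quot \<Rightarrow> 'a quot" is "\<lambda>f g K. f K - g K"
  by (use cspan_rel(5) in blast)
lift_definition uminus_quot :: "'a quot \<Rightarrow> 'a quot" is "\<lambda>f K. - f K"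
  by (use cspan_rel(6) in blast)
lift_definition scaleC_quot :: "complex \<Rightarrow> 'a quot \<Rightarrow> 'a quot" is "\<lambda>c f K. c *\<^sub>C f K"
  by (use cspan_rel(7) in blast)
instance
  by standard (transfer; simp add: cvec.span_zero algebra_simps scaleC_add_right scaleC_add_left
      scaleC_scaleC scaleC_one)+
end

lift_definition qproj :: "'v::complex_vector set \<Rightarrow> 'v \<Rightarrow> 'v quot"
  is "\<lambda>K x L. if L = K then x else 0" .

text \<open>The map out of the quotient by \<open>K\<close> induced by a linear map \<open>f\<close> that vanishes on \<open>K\<close>,
  and the map to the quotient by \<open>L\<close> induced by a linear map \<open>f\<close> that sends \<open>K\<close> to \<open>cspan L\<close>.\<close>

definition qlift :: "'v::complex_vector set \<Rightarrow> ('v \<Rightarrow> 'w::complex_vector) \<Rightarrow> 'v quot \<Rightarrow> 'w" where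
  "qlift K f X = f (rep_quot X K)"

definition qmap :: "'v::complex_vector set \<Rightarrow> 'w::complex_vector set \<Rightarrow> ('v \<Rightarrow> 'w)
    \<Rightarrow> 'v quot \<Rightarrow> 'w quot" where
  "qmap K L f = qlift K (\<lambda>x. qproj L (f x))"

lemma qproj_eq_iff: "qproj K x = qproj K y \<longleftrightarrow> x - y \<in> cspan K"
  by transfer (auto simp: cvec.span_zero)

lemma clinear_qproj: "clinear (qproj K)"
  by (rule clinearI; transfer; auto simp: cvec.span_zero)

lemma qlift_qproj:
  assumes "clinear f" "\<And>k. k \<in> K \<Longrightarrow> f k = 0"
  shows "qlift K f (qproj K x) = f x"
proof -
  interpret F: Vector_Spaces.linear scaleC scaleC f by fact
  have "\<forall>L. rep_quot (qproj K x) L - (if L = K then x else 0) \<in> cspan L"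
    unfolding qproj.abs_eq
    using Quotient3_rep_abs[OF Quotient3_quot, of "\<lambda>L. if L = K then x else 0"]
    by (simp add: cvec.span_zero)
  then have "rep_quot (qproj K x) K - x \<in> cspan K"
    by metis
  then have "f (rep_quot (qproj K x) K - x) = 0"
    using F.eq_0_on_span[of K] assms(2) by blast
  then show ?thesis
    by (simp add: qlift_def F.diff)
qed

lemma qmap_qproj:
  assumes "clinear f" "\<And>k. k \<in> K \<Longrightarrow> f k \<in> cspan L"
  shows "qmap K L f (qproj K x) = qproj L (f x)"
  unfolding qmap_def
proof (rule qlift_qproj)
  show "clinear (\<lambda>x. qproj L (f x))"
    using Vector_Spaces.linear_compose[OF assms(1) clinear_qproj] by (simp add: comp_def)
  show "qproj L (f k) = 0" if "k \<in> K" for k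
    using assms(2)[OF that] qproj_eq_iff[of L "f k" 0]
      cvec_pair.linear_0[OF clinear_qproj, of L] by simp
qed


section \<open>Modules, balanced tensor products and faithful flatness\<close>

text \<open>Structures with a carrier live on a subspace of a vector space type, and a linear map between
  carriers is given by a linear map of the ambient types; as linear maps extend from subspaces,
  this does not restrict the maps between carriers.\<close>

definition bal_rels :: "'b set \<Rightarrow> ('x \<Rightarrow> 'b \<Rightarrow> 'x) \<Rightarrow> ('b \<Rightarrow> 'y \<Rightarrow> 'y) \<Rightarrow>
    'x::complex_vector set \<Rightarrow> 'y::complex_vector set \<Rightarrow> ('x \<otimes> 'y) set" where
  "bal_rels B ract lact X Y =
     {ract x b \<otimes> y - x \<otimes> lact b y | x b y. x \<in> X \<and> b \<in> B \<and> y \<in> Y}"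

definition bal_tensor :: "'b set \<Rightarrow> ('x \<Rightarrow> 'b \<Rightarrow> 'x) \<Rightarrow> ('b \<Rightarrow> 'y \<Rightarrow> 'y) \<Rightarrow>
    'x::complex_vector set \<Rightarrow> 'y::complex_vector set \<Rightarrow> ('x \<otimes> 'y) quot set" where
  "bal_tensor B ract lact X Y = qproj (bal_rels B ract lact X Y) ` tsub X Y"

locale left_module =
  fixes B :: "'a::complex_algebra_1 set"
    and M :: "'u::complex_vector set"
    and act :: "'a \<Rightarrow> 'u \<Rightarrow> 'u"
  assumes subspace_M: "csubspace M"
    and act_closed: "b \<in> B \<Longrightarrow> x \<in> M \<Longrightarrow> act b x \<in> M"
    and act_add_left: "b \<in> B \<Longrightarrow> b' \<in> B \<Longrightarrow> x \<in> M \<Longrightarrow> act (b + b') x = act b x + act b' x"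
    and act_add_right: "b \<in> B \<Longrightarrow> x \<in> M \<Longrightarrow> y \<in> M \<Longrightarrow> act b (x + y) = act b x + act b y"
    and act_scaleC: "b \<in> B \<Longrightarrow> x \<in> M \<Longrightarrow> act (c *\<^sub>C b) x = c *\<^sub>C act b x"
    and act_mult: "b \<in> B \<Longrightarrow> b' \<in> B \<Longrightarrow> x \<in> M \<Longrightarrow> act (b * b') x = act b (act b' x)"
    and act_one: "x \<in> M \<Longrightarrow> act 1 x = x"

definition module_map :: "'a set \<Rightarrow> 'u::complex_vector set \<Rightarrow> ('a \<Rightarrow> 'u \<Rightarrow> 'u) \<Rightarrow>
    'v::complex_vector set \<Rightarrow> ('a \<Rightarrow> 'v \<Rightarrow> 'v) \<Rightarrow> ('u \<Rightarrow> 'v) \<Rightarrow> bool" where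
  "module_map B M act N act' f \<longleftrightarrow>
     clinear f \<and> f ` M \<subseteq> N \<and> (\<forall>b\<in>B. \<forall>x\<in>M. f (act b x) = act' b (f x))"

definition exact_at :: "'u set \<Rightarrow> ('u \<Rightarrow> 'v) \<Rightarrow> 'v set \<Rightarrow> ('v \<Rightarrow> 'w::zero) \<Rightarrow> bool" where
  "exact_at M f N g \<longleftrightarrow> f ` M = {y \<in> N. g y = 0}"

text \<open>The functor tensoring the right \<open>B\<close>-module \<open>'a\<close> with left \<open>B\<close>-modules preserves and reflects
  exactness. The modules range over all module structures on subspaces of \<open>nat \<Rightarrow>\<^sub>0 'a\<close>, i.e.
  up to isomorphism over all modules of dimension at most the maximum of \<open>\<aleph>\<^sub>0\<close> and the dimension
  of \<open>'a\<close>. This gives the usual notion: each element of a tensor product, and each relation it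
  satisfies, involves finitely many module elements only, so that a counterexample can be cut down
  to submodules of at most that dimension.\<close>

definition faithfully_flat_right :: "'a::complex_algebra_1 set \<Rightarrow> bool" where
  "faithfully_flat_right B \<longleftrightarrow>
    (\<forall>(M1 :: (nat \<Rightarrow>\<^sub>0 'a) set) (M2 :: (nat \<Rightarrow>\<^sub>0 'a) set) (M3 :: (nat \<Rightarrow>\<^sub>0 'a) set)
        act1 act2 act3 f g.
      left_module B M1 act1 \<and> left_module B M2 act2 \<and> left_module B M3 act3 \<and>
      module_map B M1 act1 M2 act2 f \<and> module_map B M2 act2 M3 act3 g \<longrightarrow>
      (exact_at M1 f M2 g \<longleftrightarrow>
       exact_at
         (bal_tensor B (*) act1 UNIV M1)
         (qmap (bal_rels B (*) act1 UNIV M1) (bal_rels B (*) act2 UNIV M2) (tmap id f))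
         (bal_tensor B (*) act2 UNIV M2)
         (qmap (bal_rels B (*) act2 UNIV M2) (bal_rels B (*) act3 UNIV M3) (tmap id g))))"


section \<open>Hopf algebras and quantum homogeneous spaces\<close>

locale hopf_algebra =
  fixes V :: "'a::complex_vector set"
    and m :: "'a \<Rightarrow> 'a \<Rightarrow> 'a"
    and u :: 'a
    and \<Delta> :: "'a \<Rightarrow> 'a \<otimes> 'a"
    and \<epsilon> :: "'a \<Rightarrow> complex"
    and S :: "'a \<Rightarrow> 'a"
  assumes subspace_V: "csubspace V"
    and bilinear_m: "cbilinear m"
    and m_closed: "x \<in> V \<Longrightarrow> y \<in> V \<Longrightarrow> m x y \<in> V"
    and u_closed: "u \<in> V"
    and m_assoc: "x \<in> V \<Longrightarrow> y \<in> V \<Longrightarrow> z \<in> V \<Longrightarrow> m (m x y) z = m x (m y z)"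
    and m_unit_left: "x \<in> V \<Longrightarrow> m u x = x"
    and m_unit_right: "x \<in> V \<Longrightarrow> m x u = x"
    and linear_\<Delta>: "clinear \<Delta>"
    and \<Delta>_closed: "\<Delta> ` V \<subseteq> tsub V V"
    and linear_\<epsilon>: "clinear \<epsilon>"
    and coassoc: "x \<in> V \<Longrightarrow> tassoc (tmap \<Delta> id (\<Delta> x)) = tmap id \<Delta> (\<Delta> x)"
    and counit_left: "x \<in> V \<Longrightarrow> tlift (\<lambda>y z. \<epsilon> y *\<^sub>C z) (\<Delta> x) = x"
    and counit_right: "x \<in> V \<Longrightarrow> tlift (\<lambda>y z. \<epsilon> z *\<^sub>C y) (\<Delta> x) = x"
    and \<Delta>_mult: "x \<in> V \<Longrightarrow> y \<in> V \<Longrightarrow> \<Delta> (m x y) = tmult m m (\<Delta> x) (\<Delta> y)"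
    and \<Delta>_unit: "\<Delta> u = u \<otimes> u"
    and \<epsilon>_mult: "x \<in> V \<Longrightarrow> y \<in> V \<Longrightarrow> \<epsilon> (m x y) = \<epsilon> x * \<epsilon> y"
    and \<epsilon>_unit: "\<epsilon> u = 1"
    and linear_S: "clinear S"
    and antipode_left: "x \<in> V \<Longrightarrow> tlift (\<lambda>y z. m (S y) z) (\<Delta> x) = \<epsilon> x *\<^sub>C u"
    and antipode_right: "x \<in> V \<Longrightarrow> tlift (\<lambda>y z. m y (S z)) (\<Delta> x) = \<epsilon> x *\<^sub>C u"
    and bij_S: "bij_betw S V V"

definition subcoalgebra :: "'a::complex_vector set \<Rightarrow> ('a \<Rightarrow> 'a \<otimes> 'a) \<Rightarrow> 'a set \<Rightarrow> bool" where
  "subcoalgebra V \<Delta> D \<longleftrightarrow> csubspace D \<and> D \<subseteq> V \<and> \<Delta> ` D \<subseteq> tsub D D"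

definition simple_subcoalgebra ::
  "'a::complex_vector set \<Rightarrow> ('a \<Rightarrow> 'a \<otimes> 'a) \<Rightarrow> 'a set \<Rightarrow> bool" where
  "simple_subcoalgebra V \<Delta> D \<longleftrightarrow> subcoalgebra V \<Delta> D \<and> D \<noteq> {0} \<and>
     (\<forall>E. subcoalgebra V \<Delta> E \<and> E \<subseteq> D \<longrightarrow> E = {0} \<or> E = D)"

definition cosemisimple :: "'a::complex_vector set \<Rightarrow> ('a \<Rightarrow> 'a \<otimes> 'a) \<Rightarrow> bool" where
  "cosemisimple V \<Delta> \<longleftrightarrow> V = cspan (\<Union>{D. simple_subcoalgebra V \<Delta> D})"

definition subalgebra :: "'a::complex_algebra_1 set \<Rightarrow> bool" where
  "subalgebra B \<longleftrightarrow> csubspace B \<and> 1 \<in> B \<and> (\<forall>x\<in>B. \<forall>y\<in>B. x * y \<in> B)"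

definition aug_ideal :: "('a \<Rightarrow> complex) \<Rightarrow> 'a set \<Rightarrow> 'a set" where
  "aug_ideal \<epsilon> B = {b \<in> B. \<epsilon> b = 0}"

definition prod_space :: "'a::complex_algebra_1 set \<Rightarrow> 'a set \<Rightarrow> 'a set" where
  "prod_space X Y = cspan {x * y | x y. x \<in> X \<and> y \<in> Y}"

definition quantum_homogeneous_space ::
  "('a::complex_algebra_1 \<Rightarrow> 'a \<otimes> 'a) \<Rightarrow> ('a \<Rightarrow> complex) \<Rightarrow> 'a set \<Rightarrow> bool" where
  "quantum_homogeneous_space \<Delta> \<epsilon> B \<longleftrightarrow>
     subalgebra B \<and> \<Delta> ` B \<subseteq> tsub UNIV B \<and> faithfully_flat_right B \<and>
     prod_space (aug_ideal \<epsilon> B) UNIV = prod_space UNIV (aug_ideal \<epsilon> B)"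

text \<open>The projection from \<open>'a\<close> to its quotient by \<open>B\<^sup>+ A\<close>.\<close>

definition pi_proj :: "('a::complex_algebra_1 \<Rightarrow> complex) \<Rightarrow> 'a set \<Rightarrow> 'a \<Rightarrow> 'a quot" where
  "pi_proj \<epsilon> B = qproj (prod_space (aug_ideal \<epsilon> B) UNIV)"

text \<open>The structure maps of the quotient are those induced from \<open>'a\<close>: on \<open>range (pi_proj \<epsilon> B)\<close>
  the equations below determine \<open>m\<close>, \<open>\<Delta>'\<close>, \<open>\<epsilon>'\<close>, and hence the antipode.\<close>

definition cosemisimple_hopf_quotient ::
  "('a::complex_algebra_1 \<Rightarrow> 'a \<otimes> 'a) \<Rightarrow> ('a \<Rightarrow> complex) \<Rightarrow> 'a set \<Rightarrow> bool" where
  "cosemisimple_hopf_quotient \<Delta> \<epsilon> B \<longleftrightarrow>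
     (\<exists>m \<Delta>' \<epsilon>' S'.
        hopf_algebra (range (pi_proj \<epsilon> B)) m (pi_proj \<epsilon> B 1) \<Delta>' \<epsilon>' S' \<and>
        (\<forall>x y. m (pi_proj \<epsilon> B x) (pi_proj \<epsilon> B y) = pi_proj \<epsilon> B (x * y)) \<and>
        (\<forall>x. \<Delta>' (pi_proj \<epsilon> B x) = tmap (pi_proj \<epsilon> B) (pi_proj \<epsilon> B) (\<Delta> x)) \<and>
        (\<forall>x. \<epsilon>' (pi_proj \<epsilon> B x) = \<epsilon> x) \<and>
        cosemisimple (range (pi_proj \<epsilon> B)) \<Delta>')"


section \<open>Differential calculi\<close>

text \<open>The total algebra of forms is the type \<open>'w\<close>, its multiplication is the wedge product, and
  \<open>\<Omega> k\<close> is the space of \<open>k\<close>-forms. The identification of \<open>B\<close> with \<open>\<Omega> 0\<close> is the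
  restriction of \<open>\<iota>\<close> to \<open>B\<close>.\<close>

locale differential_calculus =
  fixes B :: "'a::complex_algebra_1 set"
    and \<iota> :: "'a \<Rightarrow> 'w::complex_algebra_1"
    and \<Omega> :: "nat \<Rightarrow> 'w set"
    and d :: "'w \<Rightarrow> 'w"
  assumes subspace_\<Omega>: "csubspace (\<Omega> k)"
    and direct_sum: "\<exists>!f :: nat \<Rightarrow>\<^sub>0 'w. (\<forall>k. Poly_Mapping.lookup f k \<in> \<Omega> k) \<and>
          \<omega> = (\<Sum>k\<in>Poly_Mapping.keys f. Poly_Mapping.lookup f k)"
    and graded_mult: "\<omega> \<in> \<Omega> k \<Longrightarrow> \<nu> \<in> \<Omega> l \<Longrightarrow> \<omega> * \<nu> \<in> \<Omega> (k + l)"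
    and linear_\<iota>: "clinear \<iota>"
    and bij_\<iota>: "bij_betw \<iota> B (\<Omega> 0)"
    and \<iota>_mult: "b \<in> B \<Longrightarrow> b' \<in> B \<Longrightarrow> \<iota> (b * b') = \<iota> b * \<iota> b'"
    and \<iota>_one: "\<iota> 1 = 1"
    and linear_d: "clinear d"
    and d_degree: "\<omega> \<in> \<Omega> k \<Longrightarrow> d \<omega> \<in> \<Omega> (Suc k)"
    and d_d: "d (d \<omega>) = 0"
    and graded_Leibniz: "\<omega> \<in> \<Omega> k \<Longrightarrow> d (\<omega> * \<nu>) = d \<omega> * \<nu> + (-1) ^ k * (\<omega> * d \<nu>)"
    and generated: "subalgebra W \<Longrightarrow> \<Omega> 0 \<subseteq> W \<Longrightarrow> d ` \<Omega> 0 \<subseteq> W \<Longrightarrow> W = UNIV"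

text \<open>The coaction on forms extends the coaction of the left coideal subalgebra \<open>B\<close> given by
  restricting \<open>\<Delta>\<close>.\<close>

locale covariant_calculus = differential_calculus B \<iota> \<Omega> d
  for B :: "'a::complex_algebra_1 set"
    and \<iota> :: "'a \<Rightarrow> 'w::complex_algebra_1"
    and \<Omega> :: "nat \<Rightarrow> 'w set"
    and d :: "'w \<Rightarrow> 'w" +
  fixes \<Delta> :: "'a \<Rightarrow> 'a \<otimes> 'a"
    and \<epsilon> :: "'a \<Rightarrow> complex"
    and \<Delta>L :: "'w \<Rightarrow> 'a \<otimes> 'w"
  assumes linear_\<Delta>L: "clinear \<Delta>L"
    and \<Delta>L_coassoc: "tassoc (tmap \<Delta> id (\<Delta>L \<omega>)) = tmap id \<Delta>L (\<Delta>L \<omega>)"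
    and \<Delta>L_counit: "tlift (\<lambda>a \<nu>. \<epsilon> a *\<^sub>C \<nu>) (\<Delta>L \<omega>) = \<omega>"
    and \<Delta>L_mult: "\<Delta>L (\<omega> * \<nu>) = tmult (*) (*) (\<Delta>L \<omega>) (\<Delta>L \<nu>)"
    and \<Delta>L_one: "\<Delta>L 1 = 1 \<otimes> 1"
    and \<Delta>L_\<iota>: "b \<in> B \<Longrightarrow> \<Delta>L (\<iota> b) = tmap id \<iota> (\<Delta> b)"
    and \<Delta>L_d: "\<Delta>L (d \<omega>) = tmap id d (\<Delta>L \<omega>)"

locale star_algebra =
  fixes B :: "'a::complex_algebra_1 set"
    and star :: "'a \<Rightarrow> 'a"
  assumes subalgebra_B: "subalgebra B"
    and star_closed: "b \<in> B \<Longrightarrow> star b \<in> B"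
    and star_add: "b \<in> B \<Longrightarrow> b' \<in> B \<Longrightarrow> star (b + b') = star b + star b'"
    and star_scaleC: "b \<in> B \<Longrightarrow> star (c *\<^sub>C b) = cnj c *\<^sub>C star b"
    and star_star: "b \<in> B \<Longrightarrow> star (star b) = b"
    and star_mult: "b \<in> B \<Longrightarrow> b' \<in> B \<Longrightarrow> star (b * b') = star b' * star b"

locale star_calculus = differential_calculus B \<iota> \<Omega> d + star_algebra B star
  for B :: "'a::complex_algebra_1 set"
    and \<iota> :: "'a \<Rightarrow> 'w::complex_algebra_1"
    and \<Omega> :: "nat \<Rightarrow> 'w set"
    and d :: "'w \<Rightarrow> 'w"
    and star :: "'a \<Rightarrow> 'a" +
  fixes starW :: "'w \<Rightarrow> 'w"
  assumes starW_\<iota>: "b \<in> B \<Longrightarrow> starW (\<iota> b) = \<iota> (star b)"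
    and starW_add: "starW (\<omega> + \<nu>) = starW \<omega> + starW \<nu>"
    and starW_scaleC: "starW (c *\<^sub>C \<omega>) = cnj c *\<^sub>C starW \<omega>"
    and starW_starW: "starW (starW \<omega>) = \<omega>"
    and starW_d: "d (starW \<omega>) = starW (d \<omega>)"
    and starW_mult: "\<omega> \<in> \<Omega> k \<Longrightarrow> \<nu> \<in> \<Omega> l \<Longrightarrow>
          starW (\<omega> * \<nu>) = (-1) ^ (k * l) * (starW \<nu> * starW \<omega>)"


section \<open>Connections\<close>

text \<open>\<open>form_tensor \<Omega>\<close> is the tensor product of \<open>\<Omega> 1\<close> with itself over \<open>\<Omega> 0\<close>, that is, over \<open>B\<close>.\<close>

abbreviation form_rels :: "(nat \<Rightarrow> 'w::complex_algebra_1 set) \<Rightarrow> ('w \<otimes> 'w) set" where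
  "form_rels \<Omega> \<equiv> bal_rels (\<Omega> 0) (*) (*) (\<Omega> 1) (\<Omega> 1)"

abbreviation form_tensor :: "(nat \<Rightarrow> 'w::complex_algebra_1 set) \<Rightarrow> ('w \<otimes> 'w) quot set" where
  "form_tensor \<Omega> \<equiv> bal_tensor (\<Omega> 0) (*) (*) (\<Omega> 1) (\<Omega> 1)"

definition form_act :: "(nat \<Rightarrow> 'w::complex_algebra_1 set) \<Rightarrow> 'w \<Rightarrow>
    ('w \<otimes> 'w) quot \<Rightarrow> ('w \<otimes> 'w) quot" where
  "form_act \<Omega> b = qmap (form_rels \<Omega>) (form_rels \<Omega>) (tmap ((*) b) id)"

definition form_wedge :: "(nat \<Rightarrow> 'w::complex_algebra_1 set) \<Rightarrow> ('w \<otimes> 'w) quot \<Rightarrow> 'w" where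
  "form_wedge \<Omega> = qlift (form_rels \<Omega>) (tlift (*))"

text \<open>The coaction induced by sending \<open>\<omega> \<otimes> \<nu>\<close> to the sum of the \<open>(a * a') \<otimes> (\<omega>' \<otimes> \<nu>')\<close>, where
  \<open>\<Delta>L \<omega>\<close> is the sum of the \<open>a \<otimes> \<omega>'\<close> and \<open>\<Delta>L \<nu>\<close> that of the \<open>a' \<otimes> \<nu>'\<close>.\<close>

definition form_coaction :: "(nat \<Rightarrow> 'w::complex_algebra_1 set) \<Rightarrow>
    ('w \<Rightarrow> 'a::complex_algebra_1 \<otimes> 'w) \<Rightarrow> ('w \<otimes> 'w) quot \<Rightarrow> 'a \<otimes> ('w \<otimes> 'w) quot" where
  "form_coaction \<Omega> \<Delta>L = qlift (form_rels \<Omega>) (tlift (\<lambda>\<omega> \<nu>.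
     tlift (\<lambda>a \<omega>'. tlift (\<lambda>a' \<nu>'. (a * a') \<otimes> qproj (form_rels \<Omega>) (\<omega>' \<otimes> \<nu>')) (\<Delta>L \<nu>)) (\<Delta>L \<omega>)))"

definition connection :: "(nat \<Rightarrow> 'w::complex_algebra_1 set) \<Rightarrow> ('w \<Rightarrow> 'w) \<Rightarrow>
    ('w \<Rightarrow> ('w \<otimes> 'w) quot) \<Rightarrow> bool" where
  "connection \<Omega> d N \<longleftrightarrow>
     clinear N \<and> N ` \<Omega> 1 \<subseteq> form_tensor \<Omega> \<and>
     (\<forall>b\<in>\<Omega> 0. \<forall>\<omega>\<in>\<Omega> 1. N (b * \<omega>) = qproj (form_rels \<Omega>) (d b \<otimes> \<omega>) + form_act \<Omega> b (N \<omega>))"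

definition covariant_connection :: "(nat \<Rightarrow> 'w::complex_algebra_1 set) \<Rightarrow> ('w \<Rightarrow> 'w) \<Rightarrow>
    ('w \<Rightarrow> 'a::complex_algebra_1 \<otimes> 'w) \<Rightarrow> ('w \<Rightarrow> ('w \<otimes> 'w) quot) \<Rightarrow> bool" where
  "covariant_connection \<Omega> d \<Delta>L N \<longleftrightarrow>
     connection \<Omega> d N \<and> (\<forall>\<omega>\<in>\<Omega> 1. form_coaction \<Omega> \<Delta>L (N \<omega>) = tmap id N (\<Delta>L \<omega>))"

definition torsion :: "(nat \<Rightarrow> 'w::complex_algebra_1 set) \<Rightarrow> ('w \<Rightarrow> 'w) \<Rightarrow>
    ('w \<Rightarrow> ('w \<otimes> 'w) quot) \<Rightarrow> 'w \<Rightarrow> 'w" where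
  "torsion \<Omega> d N \<omega> = form_wedge \<Omega> (N \<omega>) - d \<omega>"

definition torsion_free :: "(nat \<Rightarrow> 'w::complex_algebra_1 set) \<Rightarrow> ('w \<Rightarrow> 'w) \<Rightarrow>
    ('w \<Rightarrow> ('w \<otimes> 'w) quot) \<Rightarrow> bool" where
  "torsion_free \<Omega> d N \<longleftrightarrow> (\<forall>\<omega>\<in>\<Omega> 1. torsion \<Omega> d N \<omega> = 0)"

end

theory Submission
  imports Defs
begin

text \<open>Write \<open>p : B \<otimes> B \<rightarrow> \<Omega>\<^sup>1\<close>, \<open>p (b \<otimes> c) = b dc\<close>. If \<open>\<sigma>\<close> is a left \<open>B\<close>-linear, left
  \<open>A\<close>-colinear section of \<open>p\<close>, then \<open>N = (d \<otimes>\<^sub>B d) \<circ> \<sigma>\<close> is a covariant connection, and it is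
  torsion-free because \<open>db \<and> dc = d (b dc)\<close>.

  To find \<open>\<sigma>\<close>, let \<open>\<chi>\<close> be the Haar functional of the cosemisimple quotient \<open>A / B\<^sup>+A\<close>, pulled back
  to \<open>A\<close>. Then \<open>P a = a\<^sub>1 \<chi>(a\<^sub>2)\<close> is \<open>B\<close>-bilinear and colinear, and its values are coinvariants;
  by faithful flatness these are the elements of \<open>B\<close>. Choose a linear map \<open>t : \<Omega>\<^sup>1 \<rightarrow> B\<close> that
  vanishes on \<open>B\<^sup>+\<Omega>\<^sup>1\<close> and satisfies \<open>d (t \<omega>) \<equiv> \<omega>\<close> modulo \<open>B\<^sup>+\<Omega>\<^sup>1\<close>. Averaging it gives
  \<open>\<sigma> \<omega> = P (\<omega>\<^sub>-\<^sub>1 S(v\<^sub>1)) \<otimes> v\<^sub>2\<close> with \<open>v = t \<omega>\<^sub>0\<close>.\<close>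


section \<open>Multilinear maps on tensor products\<close>

lemma clinear_ident: "clinear (\<lambda>x. x)"
  by (rule clinearI) auto

lemma clinear_zero: "clinear (\<lambda>x. 0)"
  by (rule clinearI) auto

lemma clinear_compose2: "clinear h \<Longrightarrow> clinear f \<Longrightarrow> clinear (\<lambda>x. h (f x))"
  using Vector_Spaces.linear_compose[of scaleC scaleC f scaleC h] by (simp add: comp_def)

lemma clinear_add: "clinear f \<Longrightarrow> clinear g \<Longrightarrow> clinear (\<lambda>x. f x + g x)"
  by (rule cvec_pair.linear_compose_add)

lemma clinear_diff: "clinear f \<Longrightarrow> clinear g \<Longrightarrow> clinear (\<lambda>x. f x - g x)"
  by (rule cvec_pair.linear_compose_sub)

lemma clinear_mult_left: "clinear f \<Longrightarrow> clinear (\<lambda>x. c * f x :: 'a::complex_algebra_1)"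
  by (rule clinearI) (auto simp: cvec_pair.linear_add cvec_pair.linear_scale distrib_left mult_scaleC_right)

lemma clinear_mult_right: "clinear f \<Longrightarrow> clinear (\<lambda>x. f x * c :: 'a::complex_algebra_1)"
  by (rule clinearI) (auto simp: cvec_pair.linear_add cvec_pair.linear_scale distrib_right mult_scaleC_left)

lemma clinear_tens_left: "clinear f \<Longrightarrow> clinear (\<lambda>x. f x \<otimes> c)"
  using cbilinear_tens clinear_compose2[of "\<lambda>x. x \<otimes> c" f] by (auto simp: cbilinear_def)

lemma clinear_tens_right: "clinear f \<Longrightarrow> clinear (\<lambda>x. c \<otimes> f x)"
  using cbilinear_tens clinear_compose2[of "\<lambda>x. c \<otimes> x" f] by (auto simp: cbilinear_def)

lemma clinear_scaleC_right: "clinear f \<Longrightarrow> clinear (\<lambda>x. c *\<^sub>C f x)"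
  by (rule cvec_pair.linear_compose_scale_right)

lemma clinear_scaleC_left: "clinear f \<Longrightarrow> clinear (\<lambda>x. f x *\<^sub>C c)"
  by (rule clinearI) (auto simp: cvec_pair.linear_add cvec_pair.linear_scale scaleC_add_left scaleC_complex_def scaleC_scaleC)

lemma clinear_complex_mult:
  "clinear f \<Longrightarrow> clinear (\<lambda>x. c * f x :: complex)" "clinear f \<Longrightarrow> clinear (\<lambda>x. f x * c :: complex)"
  using clinear_scaleC_right[of f c] clinear_scaleC_left[of f c] by (simp_all add: scaleC_complex_def)

text \<open>The representative of \<open>t\<close> is chosen independently of \<open>f\<close>, so
  \<open>tlift f t\<close> is a fixed finite combination of values of \<open>f\<close>. Hence
  \<open>linear_tlift\<close>, \<open>tlift_swap\<close> and \<open>tlift_add\<close> need no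
  bilinearity hypothesis.\<close>

lemma tlift_sum: "tlift f t =
    (\<Sum>p\<in>Poly_Mapping.keys (rep_tensor t). Poly_Mapping.lookup (rep_tensor t) p *\<^sub>C f (fst p) (snd p))"
  by (simp add: tlift_def free_ext_def)

lemma clinear_tlift_fun:
  assumes "\<And>y z. clinear (\<lambda>x. f x y z)"
  shows "clinear (\<lambda>x. tlift (f x) t)"
  unfolding tlift_sum
  by (intro cvec_pair.linear_compose_sum ballI clinear_scaleC_right assms)

lemma clinear_tlift_arg:
  "cbilinear f \<Longrightarrow> clinear g \<Longrightarrow> clinear (\<lambda>x. tlift f (g x))"
  by (rule clinear_compose2[OF clinear_tlift])

text \<open>Eta-expanded in both arguments, so that the structural rules collected in
  \<open>clin\<close> match and bilinearity side conditions are discharged by rewriting.\<close>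

lemma cbilinear_iff: "cbilinear f \<longleftrightarrow> (\<forall>x. clinear (\<lambda>y. f x y)) \<and> (\<forall>y. clinear (\<lambda>x. f x y))"
  by (simp add: cbilinear_def)

lemmas clin = clinear_ident clinear_zero clinear_add clinear_diff clinear_mult_left
  clinear_mult_right clinear_tens_left clinear_tens_right clinear_scaleC_right
  clinear_scaleC_left clinear_complex_mult clinear_tlift_fun clinear_tlift_arg cbilinear_iff
  clinear_compose2[OF clinear_qproj]

lemma linear_tlift: "clinear g \<Longrightarrow> g (tlift f t) = tlift (\<lambda>x y. g (f x y)) t"
  by (simp add: tlift_sum cvec_pair.linear_sum cvec_pair.linear_scale)

text \<open>Neither \<open>s\<close> nor \<open>t\<close> depends on a bound variable, so this is an
  exchange of two finite sums.\<close>

lemma tlift_swap: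
  "tlift (\<lambda>x y. tlift (\<lambda>z w. f x y z w) t) s = tlift (\<lambda>z w. tlift (\<lambda>x y. f x y z w) s) t"
  unfolding tlift_sum cvec.scale_sum_right
  by (subst sum.swap) (simp add: mult.commute)

lemma tlift_add: "tlift (\<lambda>x y. f x y + g x y) t = tlift f t + tlift g t"
  by (simp add: tlift_sum scaleC_add_right sum.distrib)

lemma tlift_diff: "tlift (\<lambda>x y. f x y - g x y) t = tlift f t - tlift g t"
  by (simp add: tlift_sum cvec.scale_right_diff_distrib sum_subtractf)

lemma tlift_zero: "tlift (\<lambda>x y. 0) t = 0"
  by (simp add: tlift_sum)

lemma tlift_mult_left: "tlift (\<lambda>x y. c * f x y) t = c * (tlift f t :: 'a::complex_algebra_1)"
  by (simp add: linear_tlift[of "\<lambda>x. c * x"] clin)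

section \<open>Pure tensors and extension from them\<close>

lemma tens_span: "t \<in> cspan {x \<otimes> y | x y. True}"
proof (induct t)
  case (1 r)
  interpret F: Vector_Spaces.linear scaleC scaleC "abs_tensor :: _ \<Rightarrow> 'a \<otimes> 'b"
    by (rule clinearI) (auto simp: plus_tensor.abs_eq scaleC_tensor.abs_eq)
  have r: "r = (\<Sum>p\<in>Poly_Mapping.keys r. Poly_Mapping.lookup r p *\<^sub>C Poly_Mapping.single p 1)"
    by (rule poly_mapping_eqI)
      (simp add: lookup_sum scaleC_poly_mapping.rep_eq lookup_single scaleC_complex_def
        when_def in_keys_iff if_distrib[of "(*) _"] cong: if_cong)
  have "abs_tensor (Poly_Mapping.single p 1) = fst p \<otimes> snd p" for p :: "'a \<times> 'b"
    by (simp add: tens.abs_eq)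
  then have "abs_tensor r = (\<Sum>p\<in>Poly_Mapping.keys r. Poly_Mapping.lookup r p *\<^sub>C (fst p \<otimes> snd p))"
    by (subst r) (simp add: F.sum F.scale)
  also have "\<dots> \<in> cspan {x \<otimes> y | x y. True}"
    by (intro cvec.span_sum cvec.span_scale cvec.span_base) auto
  finally show ?case .
qed

lemma clinear_eq_on_span:
  assumes "clinear f" "clinear g" "\<And>x. x \<in> X \<Longrightarrow> f x = g x" "x \<in> cspan X"
  shows "f x = g x"
  using cvec_pair.linear_eq_on[OF assms(1,2) assms(4,3)] .

lemma tensor_eqI:
  assumes "clinear f" "clinear g" "\<And>x y. f (x \<otimes> y) = g (x \<otimes> y)"
  shows "f t = g t"
  by (rule clinear_eq_on_span[OF assms(1,2) _ tens_span]) (use assms(3) in auto)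

text \<open>The representative behind \<open>tlift\<close> may have legs outside \<open>V\<close>
  and \<open>W\<close>, so a pointwise congruence over its terms would not do. Bilinearity on the
  ambient types transfers the equality from the spanning pure tensors. This is how
  \<open>\<Delta> b \<in> tsub UNIV B\<close> is exploited below.\<close>

lemma tlift_cong_tsub:
  assumes "t \<in> tsub V W" "cbilinear f" "cbilinear g"
    "\<And>x y. x \<in> V \<Longrightarrow> y \<in> W \<Longrightarrow> f x y = g x y"
  shows "tlift f t = tlift g t"
  by (rule clinear_eq_on_span[OF clinear_tlift[OF assms(2)] clinear_tlift[OF assms(3)] _
    assms(1)[unfolded tsub_def]]) (use assms(2-4) in \<open>auto simp: tlift_tens\<close>)

lemma tlift_in_subspace:
  assumes "csubspace U" "t \<in> tsub V W" "cbilinear f"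
    "\<And>x y. x \<in> V \<Longrightarrow> y \<in> W \<Longrightarrow> f x y \<in> U"
  shows "tlift f t \<in> U"
proof -
  interpret F: Vector_Spaces.linear scaleC scaleC "tlift f" by (rule clinear_tlift) fact
  have "tlift f ` cspan {x \<otimes> y | x y. x \<in> V \<and> y \<in> W} \<subseteq> U"
    unfolding F.span_image[symmetric]
    by (rule cvec.span_minimal) (use assms in \<open>auto simp: tlift_tens\<close>)
  then show ?thesis using assms(2) unfolding tsub_def by blast
qed

lemma tsub_UNIV: "t \<in> tsub UNIV UNIV"
  using tens_span by (simp add: tsub_def)

lemma tmap_tens: "clinear f \<Longrightarrow> clinear g \<Longrightarrow> tmap f g (x \<otimes> y) = f x \<otimes> g y"
  by (simp add: tmap_def tlift_tens clin)

lemma clinear_tmap: "clinear f \<Longrightarrow> clinear g \<Longrightarrow> clinear (tmap f g)"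
  by (simp add: tmap_def clinear_tlift clin)

lemma tlift_tmap:
  assumes "clinear f" "clinear g" "cbilinear h"
  shows "tlift h (tmap f g t) = tlift (\<lambda>x y. h (f x) (g y)) t"
  unfolding tmap_def
  by (subst linear_tlift[of "tlift h"]) (use assms in \<open>simp_all add: clinear_tlift tlift_tens\<close>)


section \<open>Sweedler calculus in a Hopf algebra\<close>

lemma tlift_tassoc:
  assumes "\<And>x y. clinear (\<lambda>z. f x y z)" "\<And>x z. clinear (\<lambda>y. f x y z)" "\<And>y z. clinear (\<lambda>x. f x y z)"
  shows "tlift (\<lambda>x w. tlift (f x) w) (tassoc t) = tlift (\<lambda>u z. tlift (\<lambda>x y. f x y z) u) t"
  unfolding tassoc_def
  by (simp add: linear_tlift[of "tlift (\<lambda>x w. tlift (f x) w)"] clin assms tlift_tens)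

lemma tlift_tmult:
  assumes "cbilinear f" "cbilinear m" "cbilinear n"
  shows "tlift f (tmult m n s t) = tlift (\<lambda>x y. tlift (\<lambda>x' y'. f (m x x') (n y y')) t) s"
  unfolding tmult_def
  by (simp add: linear_tlift[OF clinear_tlift[OF assms(1)]] tlift_tens[OF assms(1)])

lemma cbilinear_mult: "cbilinear ((*) :: 'a::complex_algebra_1 \<Rightarrow> _)"
  by (simp add: clin)

locale sweedler = hopf_algebra UNIV "(*)" 1 \<Delta> \<epsilon> S
  for \<Delta> :: "'a::complex_algebra_1 \<Rightarrow> 'a \<otimes> 'a" and \<epsilon> S
begin

lemmas lin = clin clinear_compose2[OF linear_\<Delta>] clinear_compose2[OF linear_\<epsilon>]
  clinear_compose2[OF linear_S]

text \<open>Trilinearity of \<open>f\<close> makes both iterated sums factor through the threefold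
  tensor product, where the coassociativity axiom applies.\<close>

lemma sw_coassoc:
  assumes "\<And>x y. clinear (\<lambda>z. f x y z)" "\<And>x z. clinear (\<lambda>y. f x y z)" "\<And>y z. clinear (\<lambda>x. f x y z)"
  shows "tlift (\<lambda>u z. tlift (\<lambda>x y. f x y z) (\<Delta> u)) (\<Delta> a) = tlift (\<lambda>x w. tlift (\<lambda>y z. f x y z) (\<Delta> w)) (\<Delta> a)"
proof -
  have "tlift (\<lambda>x w. tlift (f x) w) (tassoc (tmap \<Delta> id (\<Delta> a))) = tlift (\<lambda>x w. tlift (f x) w) (tmap id \<Delta> (\<Delta> a))"
    by (simp add: coassoc)
  then show ?thesis
    by (simp add: tlift_tassoc assms tlift_tmap lin id_def linear_\<Delta>)
qed

lemma sw_counit_left: "clinear f \<Longrightarrow> tlift (\<lambda>x y. \<epsilon> x *\<^sub>C f y) (\<Delta> a) = f a"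
  using counit_left[of a] linear_tlift[of f "\<lambda>x y. \<epsilon> x *\<^sub>C y" "\<Delta> a"]
  by (simp add: cvec_pair.linear_scale)

lemma sw_counit_right: "clinear f \<Longrightarrow> tlift (\<lambda>x y. \<epsilon> y *\<^sub>C f x) (\<Delta> a) = f a"
  using counit_right[of a] linear_tlift[of f "\<lambda>x y. \<epsilon> y *\<^sub>C x" "\<Delta> a"]
  by (simp add: cvec_pair.linear_scale)

lemma sw_antipode_left: "clinear f \<Longrightarrow> tlift (\<lambda>x y. f (S x * y)) (\<Delta> a) = \<epsilon> a *\<^sub>C f 1"
  using antipode_left[of a] linear_tlift[of f "\<lambda>x y. S x * y" "\<Delta> a"]
  by (simp add: cvec_pair.linear_scale)

lemma sw_antipode_right: "clinear f \<Longrightarrow> tlift (\<lambda>x y. f (x * S y)) (\<Delta> a) = \<epsilon> a *\<^sub>C f 1"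
  using antipode_right[of a] linear_tlift[of f "\<lambda>x y. x * S y" "\<Delta> a"]
  by (simp add: cvec_pair.linear_scale)

lemma sw_mult: "cbilinear f \<Longrightarrow>
  tlift f (\<Delta> (a * b)) = tlift (\<lambda>x y. tlift (\<lambda>x' y'. f (x * x') (y * y')) (\<Delta> b)) (\<Delta> a)"
  by (simp add: \<Delta>_mult tlift_tmult cbilinear_mult)

lemma sw_one: "cbilinear f \<Longrightarrow> tlift f (\<Delta> 1) = f 1 1"
  by (simp add: \<Delta>_unit tlift_tens)

text \<open>Uniqueness of convolution inverses: \<open>T\<close> is the sum of the
  \<open>S(x_1 y_1) x_2 y_2 S(y_3) S(x_3)\<close>, evaluated once from the right and once from the
  left.\<close>

lemma antipode_mult: "S (x * y) = S y * S x"
proof -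
  define T where "T = tlift (\<lambda>x1 xr. tlift (\<lambda>y1 yr. tlift (\<lambda>x2 x3. tlift (\<lambda>y2 y3.
     S (x1 * y1) * (x2 * (y2 * S y3) * S x3)) (\<Delta> yr)) (\<Delta> xr)) (\<Delta> y)) (\<Delta> x)"
  \<comment> \<open>Contract from the inside: first \<open>y2 * S y3\<close>, then
    \<open>x2 * S x3\<close>.\<close>
  have "T = tlift (\<lambda>x1 xr. tlift (\<lambda>y1 yr. \<epsilon> yr *\<^sub>C \<epsilon> xr *\<^sub>C S (x1 * y1)) (\<Delta> y)) (\<Delta> x)"
    unfolding T_def
    by (simp add: sw_antipode_right[of "\<lambda>u. S _ * (_ * u * S _)"] lin linear_tlift[of "\<lambda>u. \<epsilon> _ *\<^sub>C u", symmetric]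
       sw_antipode_right[of "\<lambda>u. S _ * u"])
  also have "\<dots> = S (x * y)"
    by (simp add: sw_counit_right lin sw_counit_right[of "\<lambda>u. S (u * _)"] del: cvec.scale_scale)
  finally have 1: "T = S (x * y)" .
  have "T = tlift (\<lambda>x1 xr. tlift (\<lambda>x2 x3. tlift (\<lambda>y1 yr. tlift (\<lambda>y2 y3.
     S (x1 * y1) * (x2 * (y2 * S y3) * S x3)) (\<Delta> yr)) (\<Delta> y)) (\<Delta> xr)) (\<Delta> x)"
    unfolding T_def by (subst (2) tlift_swap) (rule refl)
  also have "\<dots> = tlift (\<lambda>x1 xr. tlift (\<lambda>x2 x3. tlift (\<lambda>yl y3. tlift (\<lambda>y1 y2.
     S (x1 * y1) * (x2 * (y2 * S y3) * S x3)) (\<Delta> yl)) (\<Delta> y)) (\<Delta> xr)) (\<Delta> x)"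
    by (simp add: sw_coassoc lin)
  also have "\<dots> = tlift (\<lambda>xl x3. tlift (\<lambda>x1 x2. tlift (\<lambda>yl y3. tlift (\<lambda>y1 y2.
     S (x1 * y1) * (x2 * (y2 * S y3) * S x3)) (\<Delta> yl)) (\<Delta> y)) (\<Delta> xl)) (\<Delta> x)"
    by (subst sw_coassoc) (simp_all add: lin)
  also have "\<dots> = tlift (\<lambda>xl x3. tlift (\<lambda>yl y3. tlift (\<lambda>x1 x2. tlift (\<lambda>y1 y2.
     S (x1 * y1) * (x2 * (y2 * S y3) * S x3)) (\<Delta> yl)) (\<Delta> xl)) (\<Delta> y)) (\<Delta> x)"
    by (subst (2) tlift_swap) (rule refl)
  \<comment> \<open>The first two legs of \<open>x\<close> and of \<open>y\<close> now stand
    together and recombine into \<open>\<Delta> (xl * yl)\<close>, to which the left antipode axiom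
    applies.\<close>
  also have "\<dots> = tlift (\<lambda>xl x3. tlift (\<lambda>yl y3. tlift (\<lambda>u v.
     (S u * v) * (S y3 * S x3)) (\<Delta> (xl * yl))) (\<Delta> y)) (\<Delta> x)"
    by (simp add: sw_mult lin mult.assoc)
  also have "\<dots> = tlift (\<lambda>xl x3. tlift (\<lambda>yl y3. \<epsilon> yl *\<^sub>C \<epsilon> xl *\<^sub>C (S y3 * S x3)) (\<Delta> y)) (\<Delta> x)"
    by (subst sw_antipode_left) (simp_all add: lin \<epsilon>_mult mult.commute)
  also have "\<dots> = S y * S x"
    by (simp add: sw_counit_left lin del: cvec.scale_scale)
  finally show ?thesis using 1 by simp
qed

text \<open>Again two evaluations of one expression, now in the algebra
  \<open>A \<otimes> A\<close>: \<open>T\<close> applies \<open>f\<close> to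
  \<open>\<Delta>(S a_1) \<Delta>(a_2) (S a_4 \<otimes> S a_3)\<close>.\<close>

lemma sw_antipode:
  fixes f :: "'a \<Rightarrow> 'a \<Rightarrow> 'c::complex_vector"
  assumes f: "cbilinear f"
  shows "tlift f (\<Delta> (S a)) = tlift (\<lambda>x y. f (S y) (S x)) (\<Delta> a)"
proof -
  note f' = f[unfolded cbilinear_iff, THEN conjunct1, rule_format]
    f[unfolded cbilinear_iff, THEN conjunct2, rule_format]
  note l = lin clinear_compose2[OF f'(1)] clinear_compose2[OF f'(2)]
  define T where "T = tlift (\<lambda>x xr. tlift (\<lambda>y yr. tlift (\<lambda>y1 y2. tlift (\<lambda>y3 y4. tlift (\<lambda>s t.
      f (s * (y1 * S y4)) (t * (y2 * S y3))) (\<Delta> (S x))) (\<Delta> yr)) (\<Delta> y)) (\<Delta> xr)) (\<Delta> a)"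
  \<comment> \<open>The product \<open>\<Delta>(c_1) (S c_3 \<otimes> S c_2)\<close> collapses to
    \<open>\<epsilon>(c) 1 \<otimes> 1\<close>: the adjacent pair in the second factor cancels
    first, which makes the pair in the first factor adjacent.\<close>
  have A: "tlift (\<lambda>y yr. tlift (\<lambda>y1 y2. tlift (\<lambda>y3 y4. g (y1 * S y4) (y2 * S y3)) (\<Delta> yr)) (\<Delta> y)) (\<Delta> c)
      = \<epsilon> c *\<^sub>C g 1 1" (is "?L = _") if g: "cbilinear g" for g :: "'a \<Rightarrow> 'a \<Rightarrow> 'c" and c
  proof -
    note g' = g[unfolded cbilinear_iff, THEN conjunct1, rule_format]
      g[unfolded cbilinear_iff, THEN conjunct2, rule_format]
    note l = lin clinear_compose2[OF g'(1)] clinear_compose2[OF g'(2)]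
    have "?L = tlift (\<lambda>y1 w. tlift (\<lambda>y2 yr. tlift (\<lambda>y3 y4. g (y1 * S y4) (y2 * S y3)) (\<Delta> yr)) (\<Delta> w)) (\<Delta> c)"
      by (subst sw_coassoc) (simp_all add: l)
    also have "\<dots> = tlift (\<lambda>y1 w. tlift (\<lambda>v y4. tlift (\<lambda>y2 y3. g (y1 * S y4) (y2 * S y3)) (\<Delta> v)) (\<Delta> w)) (\<Delta> c)"
      by (simp add: sw_coassoc l)
    also have "\<dots> = tlift (\<lambda>y1 w. g (y1 * S w) 1) (\<Delta> c)"
      by (simp add: sw_antipode_right[of "g _"] sw_counit_left l)
    also have "\<dots> = \<epsilon> c *\<^sub>C g 1 1"
      by (rule sw_antipode_right) (simp add: l)
    finally show ?thesis .
  qed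
  have "T = tlift (\<lambda>x xr. \<epsilon> xr *\<^sub>C tlift f (\<Delta> (S x))) (\<Delta> a)"
    unfolding T_def
    by (subst A[of "\<lambda>p q. tlift (\<lambda>s t. f (s * p) (t * q)) (\<Delta> (S _))"]) (simp_all add: l)
  also have "\<dots> = tlift f (\<Delta> (S a))"
    by (subst sw_counit_right) (simp_all add: l)
  finally have 1: "T = tlift f (\<Delta> (S a))" .
  \<comment> \<open>For the other evaluation \<open>\<Delta>(S a_1) \<Delta>(a_2)\<close> is brought
    together as \<open>\<Delta>(S a_1 a_2)\<close>.\<close>
  have "T = tlift (\<lambda>w yr. tlift (\<lambda>x y. tlift (\<lambda>y1 y2. tlift (\<lambda>y3 y4. tlift (\<lambda>s t.
      f (s * (y1 * S y4)) (t * (y2 * S y3))) (\<Delta> (S x))) (\<Delta> yr)) (\<Delta> y)) (\<Delta> w)) (\<Delta> a)"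
    unfolding T_def by (subst sw_coassoc) (simp_all add: l)
  also have "\<dots> = tlift (\<lambda>w yr. tlift (\<lambda>x y. tlift (\<lambda>s t. tlift (\<lambda>y1 y2. tlift (\<lambda>y3 y4.
      f (s * y1 * S y4) (t * y2 * S y3)) (\<Delta> yr)) (\<Delta> y)) (\<Delta> (S x))) (\<Delta> w)) (\<Delta> a)"
    by (subst (4) tlift_swap, subst (3) tlift_swap) (simp add: mult.assoc)
  also have "\<dots> = tlift (\<lambda>w yr. tlift (\<lambda>x y. tlift (\<lambda>s t. tlift (\<lambda>y3 y4.
      f (s * S y4) (t * S y3)) (\<Delta> yr)) (\<Delta> (S x * y))) (\<Delta> w)) (\<Delta> a)"
    by (subst sw_mult) (simp_all add: l)
  also have "\<dots> = tlift (\<lambda>w yr. \<epsilon> w *\<^sub>C tlift (\<lambda>y3 y4. f (S y4) (S y3)) (\<Delta> yr)) (\<Delta> a)"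
    by (subst sw_antipode_left) (simp_all add: l sw_one)
  also have "\<dots> = tlift (\<lambda>y3 y4. f (S y4) (S y3)) (\<Delta> a)"
    by (subst sw_counit_left) (simp_all add: l)
  finally show ?thesis using 1 by simp
qed

end


section \<open>Haar functional and faithful flatness\<close>

lemma functional_separating:
  fixes E :: "'v::complex_vector set"
  assumes E: "csubspace E" and e: "e \<notin> E"
  obtains h :: "'v \<Rightarrow> complex" where "clinear h" "h e = 1" "\<And>x. x \<in> E \<Longrightarrow> h x = 0"
proof -
  obtain Bs where Bs: "Bs \<subseteq> E" "cvec.independent Bs" "E \<subseteq> cspan Bs"
    using cvec.maximal_independent_subset[of E] by metis
  have sp: "cspan Bs = E"
    using Bs cvec.span_minimal[OF Bs(1) E] by blast
  have ind: "cvec.independent (insert e Bs)"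
    using Bs e sp cvec.independent_insertI by metis
  obtain h where h: "clinear h" "\<forall>x\<in>insert e Bs. h x = (if x = e then 1 else 0 :: complex)"
    using cvec_pair.linear_independent_extend[OF ind, of "\<lambda>x. if x = e then 1 else 0"] by blast
  have "h x = 0" if "x \<in> E" for x
    by (rule clinear_eq_on_span[OF h(1) clinear_zero, of Bs]) (use h e sp that Bs in auto)
  then show ?thesis using that h by auto
qed

text \<open>The functional is the projection onto the simple subcoalgebra spanned by \<open>e\<close> along the sum of
  the other simple subcoalgebras.\<close>

lemma grouplike_functional:
  fixes \<Delta> :: "'v::complex_vector \<Rightarrow> 'v \<otimes> 'v"
  assumes lin: "clinear \<Delta>" and cs: "cosemisimple V \<Delta>" and e: "\<Delta> e = e \<otimes> e" "e \<noteq> 0" "e \<in> V"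
  obtains h where "clinear h" "h e = 1"
    "\<And>x. x \<in> V \<Longrightarrow> tlift (\<lambda>y z. h z *\<^sub>C y) (\<Delta> x) = h x *\<^sub>C e"
proof -
  let ?C = "{D. simple_subcoalgebra V \<Delta> D \<and> e \<notin> D}"
  have simpleD: "csubspace D" "x \<in> D \<Longrightarrow> \<Delta> x \<in> tsub D D" if "simple_subcoalgebra V \<Delta> D" for D x
    using that by (auto simp: simple_subcoalgebra_def subcoalgebra_def)
  \<comment> \<open>Finite sums of simple subcoalgebras avoiding \<open>e\<close> are treated by
    induction; arbitrary spans reduce to them because each element involves finitely many
    summands.\<close>
  have fin: "e \<notin> cspan (\<Union>F)" if "finite F" "F \<subseteq> ?C" for F
    using that
  proof (induction F)
    case empty
    then show ?case using e(2) by simp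
  next
    case (insert D F)
    let ?G = "cspan (\<Union>F)"
    have "e \<notin> ?G" using insert by auto
    then obtain f :: "'v \<Rightarrow> complex" where f: "clinear f" "f e = 1" "\<And>x. x \<in> ?G \<Longrightarrow> f x = 0"
      using functional_separating[of ?G e] by auto
    \<comment> \<open>The map \<open>x \<mapsto> f(x_1) x_2\<close> preserves every subcoalgebra,
      vanishes on the span of \<open>F\<close> and fixes \<open>e\<close>. Applied to
      \<open>e = x + y\<close> with \<open>x \<in> D\<close>, it would put \<open>e\<close> into
      \<open>D\<close>.\<close>
    let ?\<phi> = "\<lambda>x. tlift (\<lambda>y z. f y *\<^sub>C z) (\<Delta> x)"
    have l: "clinear ?\<phi>" "cbilinear (\<lambda>y z. f y *\<^sub>C z)"
      by (simp_all add: clin clinear_compose2[OF f(1)] lin)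
    have D: "csubspace D" "\<And>x. x \<in> D \<Longrightarrow> \<Delta> x \<in> tsub D D" "e \<notin> D"
      using insert.prems simpleD by auto
    show ?case
    proof
      assume "e \<in> cspan (\<Union>(insert D F))"
      then obtain x y where xy: "e = x + y" "x \<in> D" "y \<in> ?G"
        using D(1) by (auto simp: cvec.span_Un cvec.span_eq_iff[THEN iffD2, OF D(1)])
      have "?\<phi> y = 0"
      proof (rule clinear_eq_on_span[OF l(1) clinear_zero _ xy(3)])
        fix y assume "y \<in> \<Union>F"
        then obtain D' where D': "y \<in> D'" "D' \<in> F" by auto
        then have "\<Delta> y \<in> tsub D' D'" "D' \<subseteq> ?G"
          using insert.prems simpleD by (auto intro: cvec.span_base)
        then show "?\<phi> y = 0"
          using tlift_cong_tsub[OF _ l(2), of "\<Delta> y" D' D' "\<lambda>_ _. 0"] f(3)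
          by (auto simp: tlift_zero clin)
      qed
      moreover have "?\<phi> x \<in> D"
        using tlift_in_subspace[OF D(1) D(2)[OF xy(2)] l(2)] D(1) by (auto intro: cvec.subspace_scale)
      moreover have "?\<phi> e = e"
        using f(2) by (simp add: e(1) tlift_tens[OF l(2)])
      ultimately have "e \<in> D"
        using xy(1) cvec_pair.linear_add[OF l(1)] by simp
      with D(3) show False by simp
    qed
  qed
  let ?E = "cspan (\<Union>?C)"
  have "\<exists>F. finite F \<and> F \<subseteq> ?C \<and> x \<in> cspan (\<Union>F)" if "x \<in> ?E" for x
    using that
  proof (induction rule: cvec.span_induct_alt)
    case base
    then show ?case by (intro exI[of _ "{}"]) simp
  next
    case (step c x y)
    then obtain F D where F: "finite F" "F \<subseteq> ?C" "y \<in> cspan (\<Union>F)" "D \<in> ?C" "x \<in> D" by auto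
    have "x \<in> cspan (\<Union>(insert D F))" "y \<in> cspan (\<Union>(insert D F))"
      using F cvec.span_mono[of "\<Union>F" "\<Union>(insert D F)"] by (auto intro: cvec.span_base)
    then show ?case
      using F by (intro exI[of _ "insert D F"]) (auto intro: cvec.span_add cvec.span_scale)
  qed
  then have "e \<notin> ?E" using fin by blast
  from functional_separating[OF cvec.subspace_span this]
  obtain h :: "'v \<Rightarrow> complex" where h: "clinear h" "h e = 1" "\<And>x. x \<in> ?E \<Longrightarrow> h x = 0"
    by blast
  let ?\<psi> = "\<lambda>x. tlift (\<lambda>y z. h z *\<^sub>C y) (\<Delta> x)"
  have l: "clinear ?\<psi>" "clinear (\<lambda>x. h x *\<^sub>C e)" "cbilinear (\<lambda>y z. h z *\<^sub>C y)"
    by (simp_all add: clin clinear_compose2[OF h(1)] lin)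
  have "?\<psi> x = h x *\<^sub>C e" if "x \<in> V" for x
  \<comment> \<open>Checked on each simple \<open>D\<close>: if \<open>e \<notin> D\<close>, then
    \<open>h\<close> vanishes on \<open>D\<close> and both sides are zero; otherwise
    \<open>D\<close> is the line through \<open>e\<close>.\<close>
  proof (rule clinear_eq_on_span[OF l(1,2) _ subsetD[OF equalityD1[OF cs[unfolded cosemisimple_def]] that]])
    fix x assume "x \<in> \<Union>{D. simple_subcoalgebra V \<Delta> D}"
    then obtain D where D: "simple_subcoalgebra V \<Delta> D" "x \<in> D" by auto
    show "?\<psi> x = h x *\<^sub>C e"
    proof (cases "e \<in> D")
      case False
      then have *: "D \<subseteq> ?E" using D by (auto intro: cvec.span_base)
      then have "?\<psi> x = 0"
        using tlift_cong_tsub[OF simpleD(2)[OF D] l(3), of "\<lambda>_ _. 0"] h(3)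
        by (auto simp: tlift_zero clin)
      then show ?thesis using * h(3) D(2) by auto
    next
      case True
      \<comment> \<open>The line through a group-like element is itself a nonzero subcoalgebra, so
        simplicity forces \<open>D\<close> to equal it.\<close>
      have "cspan {e} \<subseteq> D"
        using True simpleD(1)[OF D(1)] by (simp add: cvec.span_minimal)
      moreover have "subcoalgebra V \<Delta> (cspan {e})"
        unfolding subcoalgebra_def
      proof (intro conjI)
        show "csubspace (cspan {e})" by simp
        show "cspan {e} \<subseteq> V"
          using e(3) cs unfolding cosemisimple_def
          by (metis cvec.span_minimal cvec.subspace_span empty_subsetI insert_subset)
        have "\<Delta> (c *\<^sub>C e) \<in> tsub (cspan {e}) (cspan {e})" for c
          unfolding cvec_pair.linear_scale[OF lin] e(1) tsub_def
          by (intro cvec.span_scale cvec.span_base) (auto intro: cvec.span_base)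
        then show "\<Delta> ` cspan {e} \<subseteq> tsub (cspan {e}) (cspan {e})"
          by (auto simp: cvec.span_singleton)
      qed
      moreover have "cspan {e} \<noteq> {0}"
        using e(2) cvec.span_base[of e "{e}"] by auto
      ultimately have "D = cspan {e}"
        using D(1) unfolding simple_subcoalgebra_def by blast
      then obtain c where "x = c *\<^sub>C e" using D(2) by (auto simp: cvec.span_singleton)
      then show ?thesis
        using h by (simp add: cvec_pair.linear_scale[OF l(1)] cvec_pair.linear_scale[OF l(2)] cvec_pair.linear_scale[OF lin]
           cvec_pair.linear_scale[OF h(1)] e(1) tlift_tens[OF l(3)] cvec_pair.linear_scale[OF clinear_tlift[OF l(3)]] scaleC_complex_def)
    qed
  qed
  then show ?thesis using that h by blast
qed

text \<open>Put \<open>N = B x\<close>. Flatness embeds \<open>A \<otimes>_B N\<close> into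
  \<open>A \<otimes>_B M\<close>, where \<open>a \<otimes> b x = a b \<otimes> x = 0\<close>. So
  \<open>A \<otimes>_B N\<close> vanishes, and faithfulness gives \<open>N = 0\<close>.\<close>

lemma faithfully_flat_one_tens:
  fixes B :: "'a::complex_algebra_1 set" and M :: "(nat \<Rightarrow>\<^sub>0 'a) set"
  assumes ff: "faithfully_flat_right B" and B: "subalgebra B" and M: "left_module B M act" and x: "x \<in> M"
    and rel: "1 \<otimes> x \<in> cspan (bal_rels B (*) act UNIV M)"
  shows "x = 0"
proof -
  interpret M: left_module B M act by fact
  have B': "csubspace B" "1 \<in> B" "\<And>b c. b \<in> B \<Longrightarrow> c \<in> B \<Longrightarrow> b * c \<in> B"
    using B by (auto simp: subalgebra_def)
  define N where "N = (\<lambda>b. act b x) ` B"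
  have NM: "N \<subseteq> M" using M.act_closed x by (auto simp: N_def)
  have sN: "csubspace N"
  proof (rule cvec.subspaceI)
    show "0 \<in> N"
      using M.act_scaleC[of 1 x 0] B'(1,2) x cvec.subspace_0[OF B'(1)]
      by (auto simp: N_def image_iff intro!: bexI[of _ 0])
    show "u + v \<in> N" if "u \<in> N" "v \<in> N" for u v
      using that x cvec.subspace_add[OF B'(1)] unfolding N_def by (auto simp flip: M.act_add_left)
    show "c *\<^sub>C u \<in> N" if "u \<in> N" for c u
      using that x cvec.subspace_scale[OF B'(1)] unfolding N_def by (auto simp flip: M.act_scaleC)
  qed
  have modN: "left_module B N act"
  proof
    show "act b u \<in> N" if "b \<in> B" "u \<in> N" for b u
      using that x B'(3) unfolding N_def by (auto simp flip: M.act_mult)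
  qed (use sN NM M.act_add_left M.act_add_right M.act_scaleC M.act_mult M.act_one in \<open>auto simp: subset_iff\<close>)
  have mod0: "left_module B {0 :: nat \<Rightarrow>\<^sub>0 'a} (\<lambda>_ _. 0)"
    by standard auto
  let ?KN = "bal_rels B (*) act UNIV N" and ?KM = "bal_rels B (*) act UNIV M"
    and ?K0 = "bal_rels B (*) (\<lambda>_ _. 0) UNIV {0 :: nat \<Rightarrow>\<^sub>0 'a}"
  have t0: "tsub UNIV {0 :: nat \<Rightarrow>\<^sub>0 'a} = ({0} :: ('a \<otimes> _) set)"
  proof -
    have "a \<otimes> (0 :: nat \<Rightarrow>\<^sub>0 'a) = 0" for a :: 'a
      using cvec_pair.linear_0[OF clinear_tens_right[OF clinear_ident, of a]] .
    then have *: "{a \<otimes> y | a y. a \<in> UNIV \<and> y \<in> {0 :: nat \<Rightarrow>\<^sub>0 'a}} = ({0} :: ('a \<otimes> _) set)" by auto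
    show ?thesis unfolding tsub_def * by simp
  qed
  have qp0: "qproj K 0 = 0" for K :: "('a \<otimes> (nat \<Rightarrow>\<^sub>0 'a)) set"
    by (rule cvec_pair.linear_0[OF clinear_qproj])
  have lid: "clinear (id :: 'a \<Rightarrow> 'a)" "clinear (id :: (nat \<Rightarrow>\<^sub>0 'a) \<Rightarrow> _)"
    by (simp_all add: clin id_def)
  have l0: "clinear (\<lambda>_ :: nat \<Rightarrow>\<^sub>0 'a. 0 :: nat \<Rightarrow>\<^sub>0 'a)" by (rule clin)
  have tm0: "tmap id (\<lambda>_ :: nat \<Rightarrow>\<^sub>0 'a. 0 :: nat \<Rightarrow>\<^sub>0 'a) s = (0 :: 'a \<otimes> _)" for s :: "'a \<otimes> (nat \<Rightarrow>\<^sub>0 'a)"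
    by (rule tensor_eqI[OF clinear_tmap[OF lid(1) l0] clinear_zero])
       (simp add: tmap_tens lid l0 cvec_pair.linear_0[OF clinear_tens_right[OF clinear_ident]])
  have qm0: "qmap K L (tmap id (\<lambda>_ :: nat \<Rightarrow>\<^sub>0 'a. 0 :: nat \<Rightarrow>\<^sub>0 'a)) (qproj K s) = 0" for K L :: "('a \<otimes> (nat \<Rightarrow>\<^sub>0 'a)) set" and s
    by (subst qmap_qproj) (auto simp: clinear_tmap lid l0 tm0 qp0 cvec.span_zero)
  have bt0: "bal_tensor B (*) (\<lambda>_ _. 0) UNIV {0 :: nat \<Rightarrow>\<^sub>0 'a} = {0}"
    unfolding bal_tensor_def t0 by (simp add: qp0)
  have tid: "tmap id id s = s" for s :: "'a \<otimes> (nat \<Rightarrow>\<^sub>0 'a)"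
    by (rule tensor_eqI[OF clinear_tmap[OF lid] clinear_ident]) (simp add: tmap_tens lid)
  have KNM: "tmap id id k \<in> cspan ?KM" if "k \<in> ?KN" for k
    unfolding tid by (rule cvec.span_base) (use that NM in \<open>unfold bal_rels_def, blast\<close>)
  have act0: "act b 0 = 0" if "b \<in> B" for b
    using M.act_add_right[OF that, of 0 0] cvec.subspace_0[OF M.subspace_M] by simp
  have N0: "0 \<in> N" by (rule cvec.subspace_0[OF sN])
  have maps: "module_map B {0 :: nat \<Rightarrow>\<^sub>0 'a} (\<lambda>_ _. 0) N act (\<lambda>_. 0)" "module_map B N act M act id"
    "module_map B N act {0 :: nat \<Rightarrow>\<^sub>0 'a} (\<lambda>_ _. 0) (\<lambda>_. 0)"
    using N0 NM lid l0 act0 unfolding module_map_def by auto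
  \<comment> \<open>Preservation of exactness: injectivity of \<open>N \<rightarrow> M\<close> is
    exactness at \<open>N\<close> of the sequence starting in the zero module.\<close>
  have "exact_at {0} (\<lambda>_ :: nat \<Rightarrow>\<^sub>0 'a. 0 :: nat \<Rightarrow>\<^sub>0 'a) N id"
    using N0 by (auto simp: exact_at_def)
  then have "exact_at (bal_tensor B (*) (\<lambda>_ _. 0) UNIV {0}) (qmap ?K0 ?KN (tmap id (\<lambda>_ :: nat \<Rightarrow>\<^sub>0 'a. 0 :: nat \<Rightarrow>\<^sub>0 'a)))
      (bal_tensor B (*) act UNIV N) (qmap ?KN ?KM (tmap id id))"
    using ff[unfolded faithfully_flat_right_def, rule_format, OF conjI[OF mod0 conjI[OF modN conjI[OF M conjI[OF maps(1,2)]]]]]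
    by blast
  then have inj: "s = 0" if "s \<in> bal_tensor B (*) act UNIV N" "qmap ?KN ?KM (tmap id id) s = 0" for s
    using that qm0[of ?K0 ?KN 0] unfolding exact_at_def bt0 by (auto simp: qp0)
  \<comment> \<open>Left multiplication by \<open>a\<close> on the first factor respects the
    balancing relations, so \<open>1 \<otimes> x = 0\<close> yields \<open>a \<otimes> x = 0\<close>
    for every \<open>a\<close>.\<close>
  have ax: "a \<otimes> x \<in> cspan ?KM" for a
  proof -
    have la: "clinear ((*) a)" by (simp add: clin)
    interpret L: Vector_Spaces.linear scaleC scaleC "tmap ((*) a) id :: _ \<Rightarrow> 'a \<otimes> (nat \<Rightarrow>\<^sub>0 'a)"
      by (rule clinear_tmap[OF la lid(2)])
    have "tmap ((*) a) id ` cspan ?KM \<subseteq> cspan ?KM"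
      unfolding L.span_image[symmetric]
    proof (rule cvec.span_minimal)
      show "tmap ((*) a) id ` ?KM \<subseteq> cspan ?KM"
      proof clarify
        fix k assume "k \<in> ?KM"
        then obtain c b y where k: "k = (c * b) \<otimes> y - c \<otimes> act b y" "b \<in> B" "y \<in> M"
          by (auto simp: bal_rels_def)
        have "tmap ((*) a) id k = (a * c * b) \<otimes> y - (a * c) \<otimes> act b y"
          unfolding k by (simp add: L.diff tmap_tens la lid mult.assoc)
        also have "\<dots> \<in> cspan ?KM"
          using k by (intro cvec.span_base) (auto simp: bal_rels_def)
        finally show "tmap ((*) a) id k \<in> cspan ?KM" .
      qed
    qed simp
    then have "tmap ((*) a) id (1 \<otimes> x) \<in> cspan ?KM" using rel by blast
    then show ?thesis by (simp add: tmap_tens la lid)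
  qed
  have btN: "bal_tensor B (*) act UNIV N = {0}"
  proof -
    have "qproj ?KN s = 0" if "s \<in> tsub UNIV N" for s
    proof (rule inj)
      show "qproj ?KN s \<in> bal_tensor B (*) act UNIV N" using that by (simp add: bal_tensor_def)
      have "s \<in> cspan ?KM"
      proof -
        have "tsub UNIV N \<subseteq> cspan ?KM" unfolding tsub_def
        proof (rule cvec.span_minimal)
          show "{a \<otimes> y |a y. a \<in> UNIV \<and> y \<in> N} \<subseteq> cspan ?KM"
          proof clarify
            fix a y assume "y \<in> N"
            then obtain b where b: "b \<in> B" "y = act b x" by (auto simp: N_def)
            have "(a * b) \<otimes> x - a \<otimes> act b x \<in> cspan ?KM"
              using b x by (intro cvec.span_base) (auto simp: bal_rels_def)
            from cvec.span_diff[OF ax[of "a * b"] this] show "a \<otimes> y \<in> cspan ?KM"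
              using b by simp
          qed
        qed simp
        then show ?thesis using that by blast
      qed
      then show "qmap ?KN ?KM (tmap id id) (qproj ?KN s) = 0"
        using qproj_eq_iff[of ?KM s 0]
        by (subst qmap_qproj) (auto simp: clinear_tmap lid tid qp0 dest: KNM[unfolded tid])
    qed
    moreover have "0 \<in> tsub UNIV N" unfolding tsub_def by (rule cvec.span_zero)
    ultimately show ?thesis unfolding bal_tensor_def using qp0 by (auto simp: image_iff)
  qed
  \<comment> \<open>Reflection of exactness, used with the zero module on both sides: exactness at
    \<open>N\<close> then says that \<open>N\<close> is zero.\<close>
  let ?q = "\<lambda>K L. qmap K L (tmap id (\<lambda>_ :: nat \<Rightarrow>\<^sub>0 'a. 0 :: nat \<Rightarrow>\<^sub>0 'a))"
  have "?q K L 0 = 0" for K L :: "('a \<otimes> (nat \<Rightarrow>\<^sub>0 'a)) set"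
    using qm0[of K L 0] by (simp only: qp0)
  then have "exact_at (bal_tensor B (*) (\<lambda>_ _. 0) UNIV {0}) (?q ?K0 ?KN)
      (bal_tensor B (*) act UNIV N) (?q ?KN ?K0)"
    unfolding exact_at_def bt0 btN by auto
  then have "exact_at {0} (\<lambda>_ :: nat \<Rightarrow>\<^sub>0 'a. 0 :: nat \<Rightarrow>\<^sub>0 'a) N (\<lambda>_ :: nat \<Rightarrow>\<^sub>0 'a. 0 :: nat \<Rightarrow>\<^sub>0 'a)"
    using ff[unfolded faithfully_flat_right_def, rule_format, OF conjI[OF mod0 conjI[OF modN conjI[OF mod0 conjI[OF maps(1,3)]]]]]
    by blast
  moreover have "x \<in> N" using M.act_one[OF x] B'(2) by (auto simp: N_def image_iff intro!: bexI[of _ 1])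
  ultimately show ?thesis by (auto simp: exact_at_def)
qed


section \<open>One-forms\<close>

context differential_calculus
begin

definition span_forms :: "'w set" where
  "span_forms = cspan {\<iota> b * d (\<iota> c) | b c. b \<in> B \<and> c \<in> B}"

lemma \<iota>_in: "b \<in> B \<Longrightarrow> \<iota> b \<in> \<Omega> 0"
  using bij_\<iota> by (auto simp: bij_betw_def)

lemma \<Omega>0_cases:
  assumes "\<omega> \<in> \<Omega> 0" obtains b where "b \<in> B" "\<omega> = \<iota> b"
  using assms bij_\<iota> by (auto simp: bij_betw_def)

lemma d_\<iota>_in: "b \<in> B \<Longrightarrow> d (\<iota> b) \<in> \<Omega> 1"
  using d_degree[OF \<iota>_in] by simp

lemma \<Omega>0_mult: "\<omega> \<in> \<Omega> 0 \<Longrightarrow> \<nu> \<in> \<Omega> k \<Longrightarrow> \<omega> * \<nu> \<in> \<Omega> k"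
  "\<omega> \<in> \<Omega> 0 \<Longrightarrow> \<nu> \<in> \<Omega> k \<Longrightarrow> \<nu> * \<omega> \<in> \<Omega> k"
  using graded_mult[of \<omega> 0 \<nu> k] graded_mult[of \<nu> k \<omega> 0] by auto

lemma d_mult0: "\<omega> \<in> \<Omega> 0 \<Longrightarrow> d (\<omega> * \<nu>) = d \<omega> * \<nu> + \<omega> * d \<nu>"
  using graded_Leibniz[of \<omega> 0 \<nu>] by simp

text \<open>Uniqueness in \<open>direct_sum\<close>: a decomposition of \<open>x\<close> with no
  entry in degree 1 must agree with the one concentrated there.\<close>

lemma degree_one_disjoint:
  assumes x: "x \<in> \<Omega> 1" and y: "x \<in> cspan (\<Union>(\<Omega> ` {k. k \<noteq> 1}))"
  shows "x = 0"
proof -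
  let ?P = "\<lambda>f y. (\<forall>k. Poly_Mapping.lookup f k \<in> \<Omega> k) \<and> y = (\<Sum>k\<in>Poly_Mapping.keys f. Poly_Mapping.lookup f k)"
  have 0: "0 \<in> \<Omega> k" for k by (rule cvec.subspace_0[OF subspace_\<Omega>])
  have sup: "(\<Sum>k\<in>Poly_Mapping.keys f. Poly_Mapping.lookup f k) = (\<Sum>k\<in>X. Poly_Mapping.lookup f k)"
    if "finite X" "Poly_Mapping.keys f \<subseteq> X" for X and f :: "nat \<Rightarrow>\<^sub>0 'w"
    using that by (intro sum.mono_neutral_left) (auto simp: in_keys_iff)
  have single: "?P (Poly_Mapping.single k z) z" if "z \<in> \<Omega> k" for k z
    using that 0 by (auto simp: lookup_single when_def)
  have "\<exists>f. ?P f y \<and> Poly_Mapping.lookup f 1 = 0" if "y \<in> cspan (\<Union>(\<Omega> ` {k. k \<noteq> 1}))" for y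
    using that
  proof (induction rule: cvec.span_induct_alt)
    case base
    show ?case by (rule exI[of _ 0]) (simp add: 0)
  next
    case (step c z y)
    then obtain f k where f: "?P f y" "Poly_Mapping.lookup f 1 = 0" "k \<noteq> 1" "z \<in> \<Omega> k" by auto
    let ?s = "Poly_Mapping.single k (c *\<^sub>C z)"
    have s: "?P ?s (c *\<^sub>C z)"
      using f(4) by (intro single cvec.subspace_scale[OF subspace_\<Omega>])
    let ?X = "Poly_Mapping.keys f \<union> Poly_Mapping.keys ?s"
    have "(\<Sum>i\<in>Poly_Mapping.keys (?s + f). Poly_Mapping.lookup (?s + f) i) = (\<Sum>i\<in>?X. Poly_Mapping.lookup (?s + f) i)"
      using Poly_Mapping.keys_add[of ?s f] by (intro sup) auto
    also have "\<dots> = (\<Sum>i\<in>?X. Poly_Mapping.lookup ?s i) + (\<Sum>i\<in>?X. Poly_Mapping.lookup f i)"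
      by (simp add: lookup_add sum.distrib)
    also have "\<dots> = c *\<^sub>C z + y"
      using f(1) s sup[of ?X f] sup[of ?X ?s] by auto
    finally have "?P (?s + f) (c *\<^sub>C z + y)"
      using f(1) s by (simp add: lookup_add cvec.subspace_add[OF subspace_\<Omega>])
    then show ?case
      using f by (intro exI[of _ "?s + f"]) (simp add: lookup_add lookup_single)
  qed
  then obtain f where "?P f x" "Poly_Mapping.lookup f 1 = 0" using y by blast
  moreover have "?P (Poly_Mapping.single 1 x) x" by (rule single[OF x])
  ultimately have "f = Poly_Mapping.single 1 x" using direct_sum[of x] by blast
  then show ?thesis using \<open>Poly_Mapping.lookup f 1 = 0\<close> by simp
qed

section \<open>One-forms are sums of terms \<open>b dc\<close>\<close>

lemma span_forms_sub: "span_forms \<subseteq> \<Omega> 1"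
  unfolding span_forms_def
  by (rule cvec.span_minimal[OF _ subspace_\<Omega>]) (auto simp del: One_nat_def intro: \<Omega>0_mult \<iota>_in d_\<iota>_in)

lemma span_forms_left: 
  assumes "subalgebra B" "b \<in> B" "m \<in> span_forms" shows "\<iota> b * m \<in> span_forms"
proof -
  interpret L: Vector_Spaces.linear scaleC scaleC "\<lambda>m. \<iota> b * m" by (simp add: clin)
  have "(\<lambda>m. \<iota> b * m) ` span_forms \<subseteq> span_forms"
    unfolding span_forms_def L.span_image[symmetric]
  proof (rule cvec.span_mono, clarify)
    fix x y assume "x \<in> B" "y \<in> B"
    then have "\<iota> b * (\<iota> x * d (\<iota> y)) = \<iota> (b * x) * d (\<iota> y)" "b * x \<in> B"
      using assms(1,2) by (auto simp: subalgebra_def mult.assoc \<iota>_mult)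
    then show "\<exists>b' c. \<iota> b * (\<iota> x * d (\<iota> y)) = \<iota> b' * d (\<iota> c) \<and> b' \<in> B \<and> c \<in> B"
      using \<open>y \<in> B\<close> by blast
  qed
  then show ?thesis using assms by auto
qed

text \<open>The Leibniz rule moves \<open>b\<close> to the left of the differential:
  \<open>dy b = d(y b) - y db\<close>.\<close>

lemma span_forms_right: 
  assumes "subalgebra B" "b \<in> B" "m \<in> span_forms" shows "m * \<iota> b \<in> span_forms"
proof -
  interpret L: Vector_Spaces.linear scaleC scaleC "\<lambda>m. m * \<iota> b" by (simp add: clin)
  have "(\<lambda>m. m * \<iota> b) ` span_forms \<subseteq> span_forms"
    unfolding span_forms_def L.span_image[symmetric]
  proof (rule cvec.span_minimal)
    show "(\<lambda>m. m * \<iota> b) ` {\<iota> b * d (\<iota> c) |b c. b \<in> B \<and> c \<in> B} \<subseteq> cspan {\<iota> b * d (\<iota> c) |b c. b \<in> B \<and> c \<in> B}"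
    proof clarify
      fix x y assume xy: "x \<in> B" "y \<in> B"
      have "d (\<iota> y) * \<iota> b = d (\<iota> (y * b)) - \<iota> y * d (\<iota> b)"
        using xy assms by (simp add: \<iota>_mult d_mult0 \<iota>_in)
      then have "\<iota> x * d (\<iota> y) * \<iota> b = \<iota> x * d (\<iota> (y * b)) - \<iota> (x * y) * d (\<iota> b)"
        using xy by (simp add: mult.assoc right_diff_distrib \<iota>_mult)
      also have "\<dots> \<in> cspan {\<iota> b * d (\<iota> c) |b c. b \<in> B \<and> c \<in> B}"
        using xy assms(1,2) by (intro cvec.span_diff cvec.span_base) (auto simp: subalgebra_def)
      finally show "\<iota> x * d (\<iota> y) * \<iota> b \<in> cspan {\<iota> b * d (\<iota> c) |b c. b \<in> B \<and> c \<in> B}" .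
    qed
  qed simp
  then show ?thesis using assms by auto
qed

text \<open>Degree 0, \<open>span_forms\<close> and everything in degree at least 2 together span a
  subalgebra containing \<open>B\<close> and \<open>dB\<close>, hence the whole algebra of forms.
  Comparing degree 1 parts gives the claim.\<close>

lemma \<Omega>1_span:
  assumes B: "subalgebra B"
  shows "\<Omega> 1 = span_forms"
proof -
  let ?G = "\<Omega> 0 \<union> span_forms \<union> \<Union>(\<Omega> ` {2..})"
  let ?W = "cspan ?G"
  \<comment> \<open>Taking all forms of degree at least 2 leaves only the two products of
    \<open>B\<close> with \<open>span_forms\<close> to be examined, besides \<open>B\<close> times
    \<open>B\<close>. Bilinearity then extends closure to \<open>?W\<close>, one factor at a
    time.\<close>
  have g: "x * y \<in> ?W" if xy: "x \<in> ?G" "y \<in> ?G" for x y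
  proof -
    have hi: "x * y \<in> ?W" if "x \<in> \<Omega> k" "y \<in> \<Omega> l" "k + l \<ge> 2" for k l
      using graded_mult[OF that(1,2)] that(3) by (intro cvec.span_base) auto
    have M: "x * y \<in> ?W" if "x * y \<in> span_forms"
      using that by (intro cvec.span_base) auto
    consider "x \<in> \<Omega> 0" "y \<in> \<Omega> 0" | "x \<in> \<Omega> 0" "y \<in> span_forms" | "x \<in> span_forms" "y \<in> \<Omega> 0" | "x \<in> span_forms" "y \<in> span_forms"
      | k where "x \<in> \<Omega> k" "k \<ge> 2" | k where "y \<in> \<Omega> k" "k \<ge> 2"
      using xy by auto
    then show ?thesis
    proof cases
      case 1 then show ?thesis using \<Omega>0_mult(1) by (intro cvec.span_base) auto
    next
      case 2 then show ?thesis using M span_forms_left[OF B] \<Omega>0_cases by metis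
    next
      case 3 then show ?thesis using M span_forms_right[OF B] \<Omega>0_cases by metis
    next
      case 4 then show ?thesis using hi[of 1 1] span_forms_sub by auto
    next
      case (5 k) 
      have "\<exists>l. y \<in> \<Omega> l" using xy span_forms_sub by blast
      then show ?thesis using hi[of k] 5 by (metis trans_le_add1)
    next
      case (6 k) 
      have "\<exists>l. x \<in> \<Omega> l" using xy span_forms_sub by blast
      then show ?thesis using hi[of _ k] 6 by (metis trans_le_add2)
    qed
  qed
  have g2: "x * y \<in> ?W" if "x \<in> ?G" "y \<in> ?W" for x y
    using that(2)
  proof (rule cvec.span_induct)
    show "csubspace {y. x * y \<in> ?W}"
      by (rule cvec.subspaceI) (auto simp: distrib_left mult_scaleC_right intro: cvec.span_zero cvec.span_add cvec.span_scale)
  qed (use g that in auto)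
  have g3: "x * y \<in> ?W" if "x \<in> ?W" "y \<in> ?W" for x y
    using that(1)
  proof (rule cvec.span_induct)
    show "csubspace {x. x * y \<in> ?W}"
      by (rule cvec.subspaceI) (auto simp: distrib_right mult_scaleC_left intro: cvec.span_zero cvec.span_add cvec.span_scale)
  qed (use g2 that in auto)
  have 1: "1 \<in> \<Omega> 0" using \<iota>_in[of 1] B \<iota>_one by (auto simp: subalgebra_def)
  have "subalgebra ?W"
    using g3 1 unfolding subalgebra_def by (auto intro: cvec.span_base)
  moreover have "d ` \<Omega> 0 \<subseteq> ?W"
  proof clarify
    fix x assume "x \<in> \<Omega> 0"
    then obtain b where b: "b \<in> B" "x = \<iota> b" using \<Omega>0_cases by blast
    have "d x = \<iota> 1 * d (\<iota> b)" using b \<iota>_one by simp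
    also have "\<dots> \<in> span_forms" unfolding span_forms_def using b B by (intro cvec.span_base) (auto simp: subalgebra_def)
    finally show "d x \<in> ?W" by (auto intro: cvec.span_base)
  qed
  moreover have "\<Omega> 0 \<subseteq> ?W" by (auto intro: cvec.span_base)
  ultimately have W: "?W = UNIV" using generated by blast
  show ?thesis
  proof
    show "\<Omega> 1 \<subseteq> span_forms"
    proof
      fix x assume x: "x \<in> \<Omega> 1"
      have "x \<in> cspan (span_forms \<union> (\<Omega> 0 \<union> \<Union>(\<Omega> ` {2..})))" using W by (simp add: Un_ac)
      then obtain m r where mr: "x = m + r" "m \<in> span_forms" "r \<in> cspan (\<Omega> 0 \<union> \<Union>(\<Omega> ` {2..}))"
        unfolding cvec.span_Un[of span_forms] by (auto simp: span_forms_def cvec.span_span)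
      have "cspan (\<Omega> 0 \<union> \<Union>(\<Omega> ` {2..})) \<subseteq> cspan (\<Union>(\<Omega> ` {k. k \<noteq> 1}))"
      proof (rule cvec.span_mono)
        have "{2..} \<subseteq> {k::nat. k \<noteq> 1}" "0 \<in> {k::nat. k \<noteq> 1}" by auto
        then show "\<Omega> 0 \<union> \<Union>(\<Omega> ` {2..}) \<subseteq> \<Union>(\<Omega> ` {k. k \<noteq> 1})" by blast
      qed
      moreover have "r \<in> \<Omega> 1"
        using cvec.subspace_diff[OF subspace_\<Omega>, of x 1 m] x mr span_forms_sub by auto
      ultimately have "r = 0" using degree_one_disjoint mr(3) by blast
      then show "x \<in> span_forms" using mr by simp
    qed
  qed (rule span_forms_sub)
qed

end


section \<open>The Haar projection onto a quantum homogeneous space\<close>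

locale homogeneous_space = sweedler \<Delta> \<epsilon> S
  for \<Delta> :: "'a::complex_algebra_1 \<Rightarrow> 'a \<otimes> 'a" and \<epsilon> S +
  fixes B :: "'a set"
  assumes qhs: "quantum_homogeneous_space \<Delta> \<epsilon> B"
begin

definition I :: "'a set" where "I = prod_space (aug_ideal \<epsilon> B) UNIV"

lemma subalgB: "subalgebra B"
  and ffB: "faithfully_flat_right B"
  and I_right: "I = prod_space UNIV (aug_ideal \<epsilon> B)"
  and coidealB: "b \<in> B \<Longrightarrow> \<Delta> b \<in> tsub UNIV B"
  using qhs by (auto simp: quantum_homogeneous_space_def I_def)

lemma subspaceB: "csubspace B" and one_B: "1 \<in> B" and mult_B: "b \<in> B \<Longrightarrow> c \<in> B \<Longrightarrow> b * c \<in> B"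
  using subalgB by (auto simp: subalgebra_def)

lemma span_I: "cspan I = I"
  by (simp add: I_def prod_space_def)

lemma aug_B: "b \<in> B \<Longrightarrow> b - \<epsilon> b *\<^sub>C 1 \<in> aug_ideal \<epsilon> B"
  using one_B subspaceB
  by (simp add: aug_ideal_def cvec.subspace_diff cvec.subspace_scale cvec_pair.linear_diff[OF linear_\<epsilon>]
      cvec_pair.linear_scale[OF linear_\<epsilon>] \<epsilon>_unit scaleC_complex_def)

text \<open>The unit of the quotient Hopf algebra is group-like, so
  \<open>grouplike_functional\<close> gives a functional there. Pulled back along the projection,
  its invariance holds modulo \<open>I\<close>, the span \<open>B^+ A\<close> that is divided
  out.\<close>

lemma haar_functional_exists:
  assumes "cosemisimple_hopf_quotient \<Delta> \<epsilon> B"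
  shows "\<exists>\<chi>. clinear \<chi> \<and> \<chi> 1 = 1 \<and> (\<forall>x\<in>I. \<chi> x = 0) \<and>
    (\<forall>a. tlift (\<lambda>x y. \<chi> y *\<^sub>C x) (\<Delta> a) - \<chi> a *\<^sub>C 1 \<in> I)"
proof -
  let ?\<pi> = "pi_proj \<epsilon> B"
  obtain m \<Delta>' \<epsilon>' S' where H: "hopf_algebra (range ?\<pi>) m (?\<pi> 1) \<Delta>' \<epsilon>' S'"
    and D: "\<And>x. \<Delta>' (?\<pi> x) = tmap ?\<pi> ?\<pi> (\<Delta> x)" and cs: "cosemisimple (range ?\<pi>) \<Delta>'"
    using assms unfolding cosemisimple_hopf_quotient_def by blast
  interpret H: hopf_algebra "range ?\<pi>" m "?\<pi> 1" \<Delta>' \<epsilon>' S' by (rule H)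
  have lp: "clinear ?\<pi>" unfolding pi_proj_def by (rule clinear_qproj)
  \<comment> \<open>The quotient is nonzero because its counit takes the value 1 at the
    unit.\<close>
  have "?\<pi> 1 \<noteq> 0"
    using H.\<epsilon>_unit cvec_pair.linear_0[OF H.linear_\<epsilon>] by auto
  from grouplike_functional[OF H.linear_\<Delta> cs H.\<Delta>_unit this]
  obtain h where h: "clinear h" "h (?\<pi> 1) = 1"
    "\<And>x. x \<in> range ?\<pi> \<Longrightarrow> tlift (\<lambda>y z. h z *\<^sub>C y) (\<Delta>' x) = h x *\<^sub>C ?\<pi> 1"
    by blast
  show ?thesis
  proof (intro exI[of _ "\<lambda>a. h (?\<pi> a)"] conjI ballI allI)
    show "clinear (\<lambda>a. h (?\<pi> a))" by (rule clinear_compose2[OF h(1) lp])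
    show "h (?\<pi> x) = 0" if "x \<in> I" for x
    proof -
      have "?\<pi> x = ?\<pi> 0"
        unfolding pi_proj_def qproj_eq_iff I_def[symmetric] span_I using that by simp
      then show ?thesis using cvec_pair.linear_0[OF lp] cvec_pair.linear_0[OF h(1)] by simp
    qed
    fix a
    have "?\<pi> (tlift (\<lambda>x y. h (?\<pi> y) *\<^sub>C x) (\<Delta> a)) = tlift (\<lambda>x y. h (?\<pi> y) *\<^sub>C ?\<pi> x) (\<Delta> a)"
      by (simp add: linear_tlift[OF lp] cvec_pair.linear_scale[OF lp])
    also have "\<dots> = tlift (\<lambda>y z. h z *\<^sub>C y) (\<Delta>' (?\<pi> a))"
      unfolding D by (subst tlift_tmap[OF lp lp]) (simp_all add: clin clinear_compose2[OF h(1)])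
    also have "\<dots> = ?\<pi> (h (?\<pi> a) *\<^sub>C 1)"
      by (simp add: h(3) cvec_pair.linear_scale[OF lp])
    finally show "tlift (\<lambda>x y. h (?\<pi> y) *\<^sub>C x) (\<Delta> a) - h (?\<pi> a) *\<^sub>C 1 \<in> I"
      unfolding pi_proj_def qproj_eq_iff I_def[symmetric] span_I .
  qed (rule h(2))
qed

text \<open>Uses the inverse \<open>x \<otimes> [y] \<mapsto> x S(y\<^sub>1) \<otimes> y\<^sub>2\<close> of the canonical map, and faithful
  flatness applied to the module \<open>A / B\<close>.\<close>

lemma coinvariant_in_B:
  assumes a: "\<Delta> a - a \<otimes> 1 \<in> tsub UNIV I"
  shows "a \<in> B"
proof -
  \<comment> \<open>A linear splitting of \<open>A \<rightarrow> A / B\<close> gives an idempotent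
    \<open>p\<close> with kernel \<open>B\<close>, whose image is a copy of \<open>A / B\<close>
    inside \<open>A\<close>.\<close>
  from cvec_pair.linear_exists_right_inverse_on[OF clinear_qproj[of B] cvec.subspace_UNIV]
  obtain g where g: "clinear g" and "\<forall>v\<in>range (qproj B). qproj B (g v) = v"
    by auto
  then have qg: "qproj B (g (qproj B x)) = qproj B x" for x by simp
  define p where "p x = g (qproj B x)" for x
  have lp: "clinear p" unfolding p_def by (simp add: clin clinear_compose2[OF g])
  have spB: "cspan B = B" using subspaceB by simp
  have p0: "p x = 0 \<longleftrightarrow> x \<in> B" for x
    using qg[of x] qproj_eq_iff[of B x 0] cvec_pair.linear_0[OF g] cvec_pair.linear_0[OF clinear_qproj, of B]
    unfolding p_def spB by auto
  have pB: "x - p x \<in> B" for x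
    using qg[of x] qproj_eq_iff[of B x "p x"] spB by (simp add: p_def)
  have pb: "p (b * p x) = p (b * x)" if "b \<in> B" for b x
    using p0[of "b * (x - p x)"] mult_B[OF that pB[of x]] cvec_pair.linear_diff[OF lp, of "b * x" "b * p x"]
    by (simp add: right_diff_distrib)
  have pp: "p (p x) = p x" for x
    using pb[OF one_B] by simp
  \<comment> \<open>Faithful flatness is stated for modules inside
    \<open>nat \<Rightarrow>\<^sub>0 'a\<close>, so the copy of \<open>A / B\<close> is placed at
    index 0 there. The kernel of \<open>j\<close> is \<open>B\<close>, and \<open>act\<close>
    multiplies a representative and projects again.\<close>
  define j where "j x = Poly_Mapping.single (0::nat) (p x)" for x
  have lj: "clinear j"
    unfolding j_def
    by (rule clinearI; rule poly_mapping_eqI)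
      (auto simp: lookup_add lookup_single when_def scaleC_poly_mapping.rep_eq
        cvec_pair.linear_add[OF lp] cvec_pair.linear_scale[OF lp])
  define act where "act b y = j (b * Poly_Mapping.lookup y (0::nat))" for b y
  let ?M = "range j"
  have actj: "act b (j x) = j (b * x)" if "b \<in> B" for b x
    using pb[OF that] by (simp add: act_def j_def)
  have M: "left_module B ?M act"
  proof
    show "csubspace ?M" using cvec_pair.linear_subspace_image[OF lj cvec.subspace_UNIV] .
    show "act (b + b') x = act b x + act b' x" for b b' x
      by (simp add: act_def distrib_right cvec_pair.linear_add[OF lj])
    show "act b (x + y) = act b x + act b y" for b x y
      by (simp add: act_def distrib_left lookup_add cvec_pair.linear_add[OF lj])
    show "act (c *\<^sub>C b) x = c *\<^sub>C act b x" for c b x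
      by (simp add: act_def mult_scaleC_left cvec_pair.linear_scale[OF lj])
    show "act (b * b') x = act b (act b' x)" if "b \<in> B" "b' \<in> B" "x \<in> ?M" for b b' x
      using that actj mult_B by (auto simp: mult.assoc)
    show "act 1 x = x" if "x \<in> ?M" for x
      using that actj[OF one_B] by auto
    show "act b x \<in> ?M" for b x by (simp add: act_def)
  qed
  let ?K = "bal_rels B (*) act UNIV ?M"
  let ?Q = "qproj ?K"
  \<comment> \<open>On all of \<open>A \<otimes> A\<close> this is
    \<open>x \<otimes> y \<mapsto> x S(y_1) \<otimes> [y_2]\<close>; by \<open>kill\<close> it
    vanishes on \<open>A \<otimes> I\<close>, so it compares \<open>\<Delta> a\<close> with
    \<open>a \<otimes> 1\<close>.\<close>
  let ?\<Theta> = "tlift (\<lambda>x y. tlift (\<lambda>y1 y2. ?Q ((x * S y1) \<otimes> j y2)) (\<Delta> y))"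
  note l = lin clinear_compose2[OF lj]
  have bil: "cbilinear (\<lambda>x y. tlift (\<lambda>y1 y2. ?Q ((x * S y1) \<otimes> j y2)) (\<Delta> y))"
    by (simp add: l)
  have bal: "?Q (x \<otimes> j (b * y)) = ?Q ((x * b) \<otimes> j y)" if "b \<in> B" for x b y
  proof -
    have "(x * b) \<otimes> j y - x \<otimes> act b (j y) \<in> ?K"
      using that unfolding bal_rels_def by blast
    then show ?thesis
      using qproj_eq_iff[of ?K "(x * b) \<otimes> j y" "x \<otimes> act b (j y)"] actj[OF that] by (simp add: cvec.span_base)
  qed
  \<comment> \<open>For \<open>y = b z\<close> the leg \<open>b_2\<close> lies in \<open>B\<close>
    and crosses the balanced tensor product, meeting \<open>S(b_1)\<close>. The result is a multiple
    of \<open>\<epsilon>(b) = 0\<close>.\<close>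
  have kill: "tlift (\<lambda>y1 y2. ?Q ((x * S y1) \<otimes> j y2)) (\<Delta> (b * z)) = 0"
    if b: "b \<in> aug_ideal \<epsilon> B" for x b z
  proof -
    have bB: "b \<in> B" and b0: "\<epsilon> b = 0" using b by (auto simp: aug_ideal_def)
    have "tlift (\<lambda>y1 y2. ?Q ((x * S y1) \<otimes> j y2)) (\<Delta> (b * z)) =
       tlift (\<lambda>b1 b2. tlift (\<lambda>z1 z2. ?Q ((x * S z1 * S b1) \<otimes> j (b2 * z2))) (\<Delta> z)) (\<Delta> b)"
      by (subst sw_mult) (simp_all add: l antipode_mult mult.assoc)
    also have "\<dots> = tlift (\<lambda>b1 b2. tlift (\<lambda>z1 z2. ?Q ((x * S z1 * (S b1 * b2)) \<otimes> j z2)) (\<Delta> z)) (\<Delta> b)"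
      by (rule tlift_cong_tsub[OF coidealB[OF bB]]) (simp_all add: l bal mult.assoc)
    also have "\<dots> = 0"
      by (subst sw_antipode_left) (simp_all add: l b0)
    finally show ?thesis .
  qed
  have "?\<Theta> (\<Delta> a - a \<otimes> 1) = tlift (\<lambda>_ _. 0) (\<Delta> a - a \<otimes> 1)"
  proof (rule tlift_cong_tsub[OF a bil])
    fix x y assume y: "y \<in> I"
    show "tlift (\<lambda>y1 y2. ?Q ((x * S y1) \<otimes> j y2)) (\<Delta> y) = 0"
      by (rule clinear_eq_on_span[OF _ clinear_zero _ y[unfolded I_def prod_space_def]])
        (use kill in \<open>auto simp: l\<close>)
  qed (simp add: clin)
  then have "?\<Theta> (\<Delta> a) = ?\<Theta> (a \<otimes> 1)"
    using cvec_pair.linear_diff[OF clinear_tlift[OF bil]] by (simp add: tlift_zero)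
  \<comment> \<open>The class of \<open>1\<close> in \<open>A / B\<close> is zero.\<close>
  moreover have "?\<Theta> (a \<otimes> 1) = 0"
  proof -
    have "j 1 = 0" using p0[of 1] one_B by (simp add: j_def)
    then show ?thesis
      by (simp add: tlift_tens[OF bil] sw_one l cvec_pair.linear_0[OF clinear_qproj]
        cvec_pair.linear_0[OF clinear_tens_right[OF clinear_ident]])
  qed
  \<comment> \<open>Here \<open>a_1 S(a_2) \<otimes> [a_3]\<close> collapses to
    \<open>1 \<otimes> [a]\<close>; both values together say that \<open>1 \<otimes> [a]\<close> is
    zero.\<close>
  moreover have "?\<Theta> (\<Delta> a) = ?Q (1 \<otimes> j a)"
  proof -
    have "?\<Theta> (\<Delta> a) = tlift (\<lambda>u y2. tlift (\<lambda>x y1. ?Q ((x * S y1) \<otimes> j y2)) (\<Delta> u)) (\<Delta> a)"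
      by (subst sw_coassoc) (simp_all add: l)
    also have "\<dots> = tlift (\<lambda>u y2. \<epsilon> u *\<^sub>C ?Q (1 \<otimes> j y2)) (\<Delta> a)"
      by (subst sw_antipode_right) (simp_all add: l)
    also have "\<dots> = ?Q (1 \<otimes> j a)"
      by (subst sw_counit_left) (simp_all add: l)
    finally show ?thesis .
  qed
  ultimately have "1 \<otimes> j a \<in> cspan ?K"
    using qproj_eq_iff[of ?K "1 \<otimes> j a" 0] cvec_pair.linear_0[OF clinear_qproj, of ?K] by simp
  then have "j a = 0"
    using faithfully_flat_one_tens[OF ffB subalgB M] by blast
  then have "Poly_Mapping.lookup (j a) 0 = 0" by simp
  then show ?thesis using p0[of a] by (simp add: j_def)
qed

end

locale haar_homogeneous_space = homogeneous_space +
  fixes \<chi> :: "'a \<Rightarrow> complex"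
  assumes linear_\<chi>: "clinear \<chi>" and \<chi>_one: "\<chi> 1 = 1" and \<chi>_I: "x \<in> I \<Longrightarrow> \<chi> x = 0"
    and \<chi>_inv: "tlift (\<lambda>x y. \<chi> y *\<^sub>C x) (\<Delta> a) - \<chi> a *\<^sub>C 1 \<in> I"
begin

section \<open>The Haar projection: colinearity, image and bimodule property\<close>

definition P :: "'a \<Rightarrow> 'a" where "P a = tlift (\<lambda>x y. \<chi> y *\<^sub>C x) (\<Delta> a)"

lemma linear_P: "clinear P"
  unfolding P_def by (simp add: lin clinear_compose2[OF linear_\<chi>])

lemmas lin_P = lin clinear_compose2[OF linear_\<chi>] clinear_compose2[OF linear_P]

lemma \<chi>_mult_left: "b \<in> B \<Longrightarrow> \<chi> (b * x) = \<epsilon> b * \<chi> x"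
proof -
  assume "b \<in> B"
  then have "(b - \<epsilon> b *\<^sub>C 1) * x \<in> I"
    unfolding I_def prod_space_def using aug_B by (intro cvec.span_base) auto
  then show ?thesis
    using \<chi>_I by (fastforce simp: left_diff_distrib mult_scaleC_left cvec_pair.linear_diff[OF linear_\<chi>]
      cvec_pair.linear_scale[OF linear_\<chi>] scaleC_complex_def)
qed

text \<open>Here \<open>B^+ A = A B^+\<close> enters: \<open>\<chi>\<close> vanishes on
  \<open>x (b - \<epsilon>(b) 1)\<close> as well.\<close>

lemma \<chi>_mult_right: "b \<in> B \<Longrightarrow> \<chi> (x * b) = \<epsilon> b * \<chi> x"
proof -
  assume "b \<in> B"
  then have "x * (b - \<epsilon> b *\<^sub>C 1) \<in> I"
    unfolding I_right prod_space_def using aug_B by (intro cvec.span_base) auto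
  then show ?thesis
    using \<chi>_I by (fastforce simp: right_diff_distrib mult_scaleC_right cvec_pair.linear_diff[OF linear_\<chi>]
      cvec_pair.linear_scale[OF linear_\<chi>] scaleC_complex_def)
qed

text \<open>Left colinearity of \<open>P\<close>, that is
  \<open>\<Delta>(P a) = a_1 \<otimes> P(a_2)\<close>: coassociativity, with \<open>\<chi>\<close>
  acting on the last leg.\<close>

lemma sw_P: "cbilinear f \<Longrightarrow> tlift f (\<Delta> (P a)) = tlift (\<lambda>x y. f x (P y)) (\<Delta> a)"
proof -
  assume f: "cbilinear f"
  note f' = f[unfolded cbilinear_iff, THEN conjunct1, rule_format]
    f[unfolded cbilinear_iff, THEN conjunct2, rule_format]
  note l = lin_P clinear_compose2[OF f'(1)] clinear_compose2[OF f'(2)]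
  have "tlift f (\<Delta> (P a)) = tlift (\<lambda>u z. tlift (\<lambda>x y. \<chi> z *\<^sub>C f x y) (\<Delta> u)) (\<Delta> a)"
    unfolding P_def
    by (simp add: linear_tlift[OF clinear_compose2[OF clinear_tlift[OF f] linear_\<Delta>]]
       cvec_pair.linear_scale[OF linear_\<Delta>] cvec_pair.linear_scale[OF clinear_tlift[OF f]]
       linear_tlift[OF clinear_scaleC_right[OF clinear_ident]])
  also have "\<dots> = tlift (\<lambda>x w. tlift (\<lambda>y z. \<chi> z *\<^sub>C f x y) (\<Delta> w)) (\<Delta> a)"
    by (subst sw_coassoc) (simp_all add: l)
  also have "\<dots> = tlift (\<lambda>x y. f x (P y)) (\<Delta> a)"
    unfolding P_def by (simp add: linear_tlift[OF f'(1)] cvec_pair.linear_scale[OF f'(1)])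
  finally show ?thesis .
qed

text \<open>By colinearity, \<open>\<Delta>(P a) - P a \<otimes> 1\<close> is the sum of the
  \<open>a_1 \<otimes> (P a_2 - \<chi>(a_2) 1)\<close>, and \<open>\<chi>_inv\<close> places each
  second leg in \<open>I\<close>. So \<open>P a\<close> is coinvariant.\<close>

lemma P_in_B: "P a \<in> B"
proof (rule coinvariant_in_B)
  have "\<Delta> (P a) = tlift (\<otimes>) (\<Delta> (P a))"
    by (rule tensor_eqI[OF clinear_ident]) (simp_all add: clin tlift_tens)
  also have "\<dots> = tlift (\<lambda>x y. x \<otimes> P y) (\<Delta> a)"
    by (rule sw_P) (simp add: clin)
  finally have 1: "\<Delta> (P a) = \<dots>" .
  have 2: "P a \<otimes> 1 = tlift (\<lambda>x y. x \<otimes> (\<chi> y *\<^sub>C 1)) (\<Delta> a)"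
    unfolding P_def
    by (simp add: linear_tlift[OF clinear_tens_left[OF clinear_ident]] cvec_pair.linear_scale[OF clinear_tens_left[OF clinear_ident]]
      cvec_pair.linear_scale[OF clinear_tens_right[OF clinear_ident]])
  have "\<Delta> (P a) - P a \<otimes> 1 = tlift (\<lambda>x y. x \<otimes> (P y - \<chi> y *\<^sub>C 1)) (\<Delta> a)"
    unfolding 1 2 by (simp add: tlift_diff cvec_pair.linear_diff[OF clinear_tens_right[OF clinear_ident]])
  also have "\<dots> \<in> tsub UNIV I"
  proof (rule tlift_in_subspace[OF _ tsub_UNIV])
    show "x \<otimes> (P y - \<chi> y *\<^sub>C 1) \<in> tsub UNIV I" for x y
      unfolding tsub_def using \<chi>_inv[of y] by (intro cvec.span_base) (auto simp: P_def)
  qed (simp_all add: tsub_def lin_P)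
  finally show "\<Delta> (P a) - P a \<otimes> 1 \<in> tsub UNIV I" .
qed

lemma P_one: "P 1 = 1"
  unfolding P_def by (subst sw_one) (simp_all add: lin_P \<chi>_one)

text \<open>The leg \<open>b_2\<close> lies in \<open>B\<close>, so \<open>\<chi>\<close> turns it
  into the scalar \<open>\<epsilon>(b_2)\<close>, which the counit axiom absorbs into
  \<open>b_1\<close>.\<close>

lemma P_mult_left: assumes "b \<in> B" shows "P (b * x) = b * P x"
proof -
  have "P (b * x) = tlift (\<lambda>b1 b2. tlift (\<lambda>x1 x2. \<chi> (b2 * x2) *\<^sub>C (b1 * x1)) (\<Delta> x)) (\<Delta> b)"
    unfolding P_def by (subst sw_mult) (simp_all add: lin_P)
  also have "\<dots> = tlift (\<lambda>b1 b2. \<epsilon> b2 *\<^sub>C tlift (\<lambda>x1 x2. \<chi> x2 *\<^sub>C (b1 * x1)) (\<Delta> x)) (\<Delta> b)"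
    by (rule tlift_cong_tsub[OF coidealB[OF assms]])
      (simp_all add: lin_P linear_tlift[OF clinear_scaleC_right[OF clinear_ident]] \<chi>_mult_left)
  also have "\<dots> = tlift (\<lambda>x1 x2. \<chi> x2 *\<^sub>C (b * x1)) (\<Delta> x)"
    by (subst sw_counit_right) (simp_all add: lin_P)
  finally show ?thesis
    by (simp add: P_def tlift_mult_left[symmetric] mult_scaleC_right)
qed

lemma P_mult_right: assumes "b \<in> B" shows "P (x * b) = P x * b"
proof -
  have "P (x * b) = tlift (\<lambda>x1 x2. tlift (\<lambda>b1 b2. \<chi> (x2 * b2) *\<^sub>C (x1 * b1)) (\<Delta> b)) (\<Delta> x)"
    unfolding P_def by (subst sw_mult) (simp_all add: lin_P)
  also have "\<dots> = tlift (\<lambda>b1 b2. tlift (\<lambda>x1 x2. \<chi> (x2 * b2) *\<^sub>C (x1 * b1)) (\<Delta> x)) (\<Delta> b)"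
    by (rule tlift_swap)
  also have "\<dots> = tlift (\<lambda>b1 b2. \<epsilon> b2 *\<^sub>C tlift (\<lambda>x1 x2. \<chi> x2 *\<^sub>C (x1 * b1)) (\<Delta> x)) (\<Delta> b)"
    by (rule tlift_cong_tsub[OF coidealB[OF assms]])
      (simp_all add: lin_P linear_tlift[OF clinear_scaleC_right[OF clinear_ident]] \<chi>_mult_right)
  also have "\<dots> = tlift (\<lambda>x1 x2. \<chi> x2 *\<^sub>C (x1 * b)) (\<Delta> x)"
    by (subst sw_counit_right) (simp_all add: lin_P)
  finally show ?thesis
    by (simp add: P_def linear_tlift[OF clinear_mult_right[OF clinear_ident]] mult_scaleC_left)
qed

end


section \<open>The connection\<close>

locale haar_calculus = haar_homogeneous_space \<Delta> \<epsilon> S B \<chi> + covariant_calculus B \<iota> \<Omega> d \<Delta> \<epsilon> \<Delta>L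
  for \<Delta> :: "'a::complex_algebra_1 \<Rightarrow> 'a \<otimes> 'a" and \<epsilon> S B \<chi>
    and \<iota> :: "'a \<Rightarrow> 'w::complex_algebra_1" and \<Omega> d \<Delta>L
begin

lemmas lin_calc = lin_P clinear_compose2[OF linear_\<Delta>L] clinear_compose2[OF linear_\<iota>]
  clinear_compose2[OF linear_d]

section \<open>Sweedler rules for the coaction on forms\<close>

lemma swL_coassoc:
  assumes "\<And>x y. clinear (\<lambda>z. f x y z)" "\<And>x z. clinear (\<lambda>y. f x y z)" "\<And>y z. clinear (\<lambda>x. f x y z)"
  shows "tlift (\<lambda>u z. tlift (\<lambda>x y. f x y z) (\<Delta> u)) (\<Delta>L \<omega>) = tlift (\<lambda>x w. tlift (\<lambda>y z. f x y z) (\<Delta>L w)) (\<Delta>L \<omega>)"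
proof -
  have "tlift (\<lambda>x w. tlift (f x) w) (tassoc (tmap \<Delta> id (\<Delta>L \<omega>))) = tlift (\<lambda>x w. tlift (f x) w) (tmap id \<Delta>L (\<Delta>L \<omega>))"
    by (simp add: \<Delta>L_coassoc)
  then show ?thesis
    by (simp add: tlift_tassoc assms tlift_tmap lin_calc id_def linear_\<Delta>L linear_\<Delta>)
qed

lemma swL_counit: "clinear f \<Longrightarrow> tlift (\<lambda>x y. \<epsilon> x *\<^sub>C f y) (\<Delta>L \<omega>) = f \<omega>"
  using \<Delta>L_counit[of \<omega>] linear_tlift[of f "\<lambda>x y. \<epsilon> x *\<^sub>C y" "\<Delta>L \<omega>"]
  by (simp add: cvec_pair.linear_scale)

lemma swL_mult: "cbilinear f \<Longrightarrow>
  tlift f (\<Delta>L (\<omega> * \<nu>)) = tlift (\<lambda>x y. tlift (\<lambda>x' y'. f (x * x') (y * y')) (\<Delta>L \<nu>)) (\<Delta>L \<omega>)"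
  by (simp add: \<Delta>L_mult tlift_tmult cbilinear_mult)

lemma swL_\<iota>: "cbilinear f \<Longrightarrow> b \<in> B \<Longrightarrow> tlift f (\<Delta>L (\<iota> b)) = tlift (\<lambda>x y. f x (\<iota> y)) (\<Delta> b)"
  by (simp add: \<Delta>L_\<iota> tlift_tmap linear_\<iota> clin id_def)

lemma swL_d: "cbilinear f \<Longrightarrow> tlift f (\<Delta>L (d \<omega>)) = tlift (\<lambda>x \<nu>. f x (d \<nu>)) (\<Delta>L \<omega>)"
  by (simp add: \<Delta>L_d tlift_tmap linear_d clin id_def)

lemma swL_d\<iota>: "cbilinear f \<Longrightarrow> b \<in> B \<Longrightarrow> tlift f (\<Delta>L (d (\<iota> b))) = tlift (\<lambda>x y. f x (d (\<iota> y))) (\<Delta> b)"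
proof -
  assume f: "cbilinear f" and b: "b \<in> B"
  note f' = f[unfolded cbilinear_iff, THEN conjunct1, rule_format]
    f[unfolded cbilinear_iff, THEN conjunct2, rule_format]
  show ?thesis
    unfolding swL_d[OF f]
    by (rule swL_\<iota>[OF _ b]) (simp add: lin_calc clinear_compose2[OF f'(1)] clinear_compose2[OF f'(2)])
qed

lemma \<Omega>1_eq: "\<Omega> 1 = span_forms" by (rule \<Omega>1_span[OF subalgB])

text \<open>Preservation of degree 1 follows on the spanning elements \<open>b dc\<close>: the
  coaction is multiplicative and commutes with \<open>d\<close>, and the second legs of
  \<open>\<Delta> b\<close> and \<open>\<Delta> c\<close> stay in \<open>B\<close>.\<close>

lemma \<Delta>L_\<Omega>1: "\<omega> \<in> \<Omega> 1 \<Longrightarrow> \<Delta>L \<omega> \<in> tsub UNIV (\<Omega> 1)"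
proof -
  interpret L: Vector_Spaces.linear scaleC scaleC \<Delta>L by (rule linear_\<Delta>L)
  have id: "t = tlift (\<otimes>) t" for t :: "'a \<otimes> 'w"
    by (rule tensor_eqI[OF clinear_ident]) (simp_all add: clin tlift_tens)
  have sub: "csubspace (tsub UNIV (\<Omega> 1))" by (simp add: tsub_def)
  have "\<Delta>L ` span_forms \<subseteq> tsub UNIV (\<Omega> 1)"
    unfolding span_forms_def L.span_image[symmetric]
  proof (rule cvec.span_minimal[OF _ sub], clarify)
    fix b c assume bc: "b \<in> B" "c \<in> B"
    have "\<Delta>L (\<iota> b * d (\<iota> c)) = tlift (\<otimes>) (\<Delta>L (\<iota> b * d (\<iota> c)))" by (rule id)
    also have "\<dots> = tlift (\<lambda>b1 b2. tlift (\<lambda>c1 c2. (b1 * c1) \<otimes> (\<iota> b2 * d (\<iota> c2))) (\<Delta> c)) (\<Delta> b)"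
      by (simp add: swL_mult swL_\<iota> swL_d\<iota> lin_calc bc)
    also have "\<dots> \<in> tsub UNIV (\<Omega> 1)"
    proof (rule tlift_in_subspace[OF sub coidealB[OF bc(1)]])
      fix b1 b2 assume b2: "b2 \<in> B"
      show "tlift (\<lambda>c1 c2. (b1 * c1) \<otimes> (\<iota> b2 * d (\<iota> c2))) (\<Delta> c) \<in> tsub UNIV (\<Omega> 1)"
      proof (rule tlift_in_subspace[OF sub coidealB[OF bc(2)]])
        show "(b1 * c1) \<otimes> (\<iota> b2 * d (\<iota> c2)) \<in> tsub UNIV (\<Omega> 1)" if "c2 \<in> B" for c1 c2
          unfolding tsub_def using \<Omega>0_mult(1)[OF \<iota>_in[OF b2] d_\<iota>_in[OF that]]
          by (intro cvec.span_base) blast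
      qed (simp add: lin_calc)
    qed (simp add: lin_calc)
    finally show "\<Delta>L (\<iota> b * d (\<iota> c)) \<in> tsub UNIV (\<Omega> 1)" .
  qed
  then show "\<omega> \<in> \<Omega> 1 \<Longrightarrow> \<Delta>L \<omega> \<in> tsub UNIV (\<Omega> 1)" unfolding \<Omega>1_eq by blast
qed

text \<open>This is \<open>B^+ \<Omega>^1\<close>; the quotient of \<open>\<Omega> 1\<close> by it
  is the fibre of the one-forms at the character \<open>\<epsilon>\<close> of
  \<open>B\<close>.\<close>

definition K :: "'w set" where
  "K = cspan {\<iota> b * \<omega> | b \<omega>. b \<in> aug_ideal \<epsilon> B \<and> \<omega> \<in> \<Omega> 1}"

lemma K_diff: "b \<in> B \<Longrightarrow> \<omega> \<in> \<Omega> 1 \<Longrightarrow> \<iota> b * \<omega> - \<epsilon> b *\<^sub>C \<omega> \<in> K"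
proof -
  assume b: "b \<in> B" "\<omega> \<in> \<Omega> 1"
  have "\<iota> b * \<omega> - \<epsilon> b *\<^sub>C \<omega> = \<iota> (b - \<epsilon> b *\<^sub>C 1) * \<omega>"
    by (simp add: cvec_pair.linear_diff[OF linear_\<iota>] cvec_pair.linear_scale[OF linear_\<iota>] \<iota>_one
      left_diff_distrib mult_scaleC_left)
  also have "\<dots> \<in> K" unfolding K_def using aug_B[OF b(1)] b(2) by (intro cvec.span_base) blast
  finally show ?thesis .
qed

text \<open>Modulo \<open>K\<close> one has \<open>b dc = d(\<epsilon>(b) c)\<close>, so
  \<open>c \<mapsto> [dc]\<close> already maps \<open>B\<close> onto the fibre. A linear right
  inverse, composed with the projection to the fibre, is the required \<open>t\<close>; no
  covariance is asked of it.\<close>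

lemma fibre_section_exists:
  "\<exists>t. clinear t \<and> (\<forall>\<omega>. t \<omega> \<in> B) \<and> (\<forall>k\<in>K. t k = 0) \<and>
    (\<forall>\<omega>\<in>\<Omega> 1. d (\<iota> (t \<omega>)) - \<omega> \<in> K)"
proof -
  let ?q = "qproj K" and ?f = "\<lambda>b. qproj K (d (\<iota> b))"
  have lf: "clinear ?f" by (simp add: lin_calc)
  have spK: "cspan K = K" by (simp add: K_def)
  from cvec_pair.linear_exists_right_inverse_on[OF lf subspaceB]
  obtain g where g: "range g \<subseteq> B" "clinear g" "\<forall>v\<in>?f ` B. ?f (g v) = v" by auto
  have "?q ` \<Omega> 1 \<subseteq> ?f ` B"
  proof -
    have "csubspace (?f ` B)" by (rule cvec_pair.linear_subspace_image[OF lf subspaceB])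
    moreover have "?q (\<iota> b * d (\<iota> c)) \<in> ?f ` B" if "b \<in> B" "c \<in> B" for b c
    proof -
      have "?q (\<iota> b * d (\<iota> c)) = ?q (\<epsilon> b *\<^sub>C d (\<iota> c))"
        unfolding qproj_eq_iff spK by (rule K_diff[OF that(1) d_\<iota>_in[OF that(2)]])
      also have "\<dots> = ?f (\<epsilon> b *\<^sub>C c)"
        by (simp add: cvec_pair.linear_scale[OF linear_d] cvec_pair.linear_scale[OF linear_\<iota>])
      finally show ?thesis using cvec.subspace_scale[OF subspaceB that(2)] by blast
    qed
    ultimately show ?thesis
      unfolding \<Omega>1_eq span_forms_def cvec_pair.linear_span_image[OF clinear_qproj, symmetric]
      by (intro cvec.span_minimal) auto
  qed
  then have *: "?q (d (\<iota> (g (?q \<omega>)))) = ?q \<omega>" if "\<omega> \<in> \<Omega> 1" for \<omega>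
    using g(3) that by blast
  show ?thesis
  proof (intro exI[of _ "\<lambda>\<omega>. g (?q \<omega>)"] conjI ballI allI)
    show "clinear (\<lambda>\<omega>. g (?q \<omega>))" by (rule clinear_compose2[OF g(2) clinear_qproj])
    show "g (?q k) = 0" if "k \<in> K" for k
    proof -
      have "?q k = ?q 0" unfolding qproj_eq_iff spK using that by simp
      then show ?thesis using cvec_pair.linear_0[OF g(2)] cvec_pair.linear_0[OF clinear_qproj, of K] by simp
    qed
    show "d (\<iota> (g (?q \<omega>))) - \<omega> \<in> K" if "\<omega> \<in> \<Omega> 1" for \<omega>
      using *[OF that] unfolding qproj_eq_iff spK .
  qed (use g in auto)
qed

end

section \<open>Averaging \<open>t\<close> to a section of
  \<open>b \<otimes> c \<mapsto> b dc\<close>\<close>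

locale fibre_section = haar_calculus \<Delta> \<epsilon> S B \<chi> \<iota> \<Omega> d \<Delta>L
  for \<Delta> :: "'a::complex_algebra_1 \<Rightarrow> 'a \<otimes> 'a" and \<epsilon> S B \<chi>
    and \<iota> :: "'a \<Rightarrow> 'w::complex_algebra_1" and \<Omega> d \<Delta>L +
  fixes t :: "'w \<Rightarrow> 'a"
  assumes linear_t: "clinear t" and t_B: "t \<omega> \<in> B" and t_K: "k \<in> K \<Longrightarrow> t k = 0"
    and t_section: "\<omega> \<in> \<Omega> 1 \<Longrightarrow> d (\<iota> (t \<omega>)) - \<omega> \<in> K"
begin

lemmas lin_sec = lin_calc clinear_compose2[OF linear_t]

lemma t_mult: "b \<in> B \<Longrightarrow> \<omega> \<in> \<Omega> 1 \<Longrightarrow> t (\<iota> b * \<omega>) = \<epsilon> b *\<^sub>C t \<omega>"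
  using t_K[OF K_diff[of b \<omega>]] by (simp add: cvec_pair.linear_diff[OF linear_t] cvec_pair.linear_scale[OF linear_t])

text \<open>Right \<open>B\<close>-linearity of \<open>P\<close> lets the antipode cancel: \<open>P (x S(b\<^sub>1)) b\<^sub>2 = \<epsilon>(b) P x\<close>.\<close>

lemma P_kills_K:
  assumes "k \<in> K"
  shows "tlift (\<lambda>b \<eta>. \<iota> (P (a * S b)) * \<eta>) (\<Delta>L k) = 0"
proof (rule clinear_eq_on_span[OF _ clinear_zero _ assms[unfolded K_def]])
  show "clinear (\<lambda>k. tlift (\<lambda>b \<eta>. \<iota> (P (a * S b)) * \<eta>) (\<Delta>L k))" by (simp add: lin_sec)
  fix k assume "k \<in> {\<iota> b * \<omega> | b \<omega>. b \<in> aug_ideal \<epsilon> B \<and> \<omega> \<in> \<Omega> 1}"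
  then obtain b \<omega> where k: "k = \<iota> b * \<omega>" and b: "b \<in> B" "\<epsilon> b = 0"
    by (auto simp: aug_ideal_def)
  have "tlift (\<lambda>b \<eta>. \<iota> (P (a * S b)) * \<eta>) (\<Delta>L k)
      = tlift (\<lambda>b1 b2. tlift (\<lambda>x \<eta>. \<iota> (P (a * S x * S b1)) * \<iota> b2 * \<eta>) (\<Delta>L \<omega>)) (\<Delta> b)"
    unfolding k by (simp add: swL_mult swL_\<iota> b lin_sec antipode_mult mult.assoc)
  also have "\<dots> = tlift (\<lambda>b1 b2. tlift (\<lambda>x \<eta>. \<iota> (P (a * S x * (S b1 * b2))) * \<eta>) (\<Delta>L \<omega>)) (\<Delta> b)"
  proof (rule tlift_cong_tsub[OF coidealB[OF b(1)]])
    fix b1 b2 assume b2: "b2 \<in> B"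
    have "\<iota> (P y) * \<iota> b2 = \<iota> (P (y * b2))" for y
      by (simp add: P_mult_right[OF b2] \<iota>_mult[OF P_in_B b2])
    then show "tlift (\<lambda>x \<eta>. \<iota> (P (a * S x * S b1)) * \<iota> b2 * \<eta>) (\<Delta>L \<omega>) =
       tlift (\<lambda>x \<eta>. \<iota> (P (a * S x * (S b1 * b2))) * \<eta>) (\<Delta>L \<omega>)"
      by (simp add: mult.assoc)
  qed (simp_all add: lin_sec)
  also have "\<dots> = 0"
    by (subst sw_antipode_left) (simp_all add: lin_sec b)
  finally show "tlift (\<lambda>b \<eta>. \<iota> (P (a * S b)) * \<eta>) (\<Delta>L k) = 0" .
qed

text \<open>This is \<open>p (\<sigma> \<omega>) = \<omega>\<close>. Since
  \<open>d (t \<nu>)\<close> and \<open>\<nu>\<close> agree modulo \<open>K\<close>,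
  \<open>P_kills_K\<close> allows the coaction of \<open>\<nu>\<close> itself to replace that of
  \<open>d (t \<nu>)\<close>. Coassociativity then produces \<open>a_1 S(a_2)\<close>, leaving
  \<open>P 1 = 1\<close>.\<close>

lemma section_identity:
  assumes "\<omega> \<in> \<Omega> 1"
  shows "tlift (\<lambda>a \<nu>. tlift (\<lambda>b c. \<iota> (P (a * S b)) * d (\<iota> c)) (\<Delta> (t \<nu>))) (\<Delta>L \<omega>) = \<omega>"
proof -
  have "tlift (\<lambda>a \<nu>. tlift (\<lambda>b c. \<iota> (P (a * S b)) * d (\<iota> c)) (\<Delta> (t \<nu>))) (\<Delta>L \<omega>)
      = tlift (\<lambda>a \<nu>. tlift (\<lambda>b \<eta>. \<iota> (P (a * S b)) * \<eta>) (\<Delta>L \<nu>)) (\<Delta>L \<omega>)"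
  proof (rule tlift_cong_tsub[OF \<Delta>L_\<Omega>1[OF assms]])
    fix a \<nu> assume \<nu>: "\<nu> \<in> \<Omega> 1"
    let ?F = "\<lambda>\<nu>. tlift (\<lambda>b \<eta>. \<iota> (P (a * S b)) * \<eta>) (\<Delta>L \<nu>)"
    have "tlift (\<lambda>b c. \<iota> (P (a * S b)) * d (\<iota> c)) (\<Delta> (t \<nu>)) = ?F (d (\<iota> (t \<nu>)))"
      by (rule swL_d\<iota>[symmetric, OF _ t_B]) (simp add: lin_sec)
    also have "\<dots> = ?F \<nu> + ?F (d (\<iota> (t \<nu>)) - \<nu>)"
      by (subst cvec_pair.linear_diff[of ?F]) (simp_all add: lin_sec)
    also have "\<dots> = ?F \<nu>" using P_kills_K[OF t_section[OF \<nu>]] by simp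
    finally show "tlift (\<lambda>b c. \<iota> (P (a * S b)) * d (\<iota> c)) (\<Delta> (t \<nu>)) = ?F \<nu>" .
  qed (simp_all add: lin_sec)
  also have "\<dots> = tlift (\<lambda>u \<eta>. tlift (\<lambda>a b. \<iota> (P (a * S b)) * \<eta>) (\<Delta> u)) (\<Delta>L \<omega>)"
    by (subst swL_coassoc) (simp_all add: lin_sec)
  also have "\<dots> = tlift (\<lambda>u \<eta>. \<epsilon> u *\<^sub>C (\<iota> (P 1) * \<eta>)) (\<Delta>L \<omega>)"
    by (subst sw_antipode_right) (simp_all add: lin_sec)
  also have "\<dots> = \<omega>"
    by (subst swL_counit) (simp_all add: lin_sec P_one \<iota>_one)
  finally show ?thesis .
qed

text \<open>This is \<open>(d \<otimes> d) \<circ> \<sigma>\<close> with values in the tensor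
  product over the complex numbers. Since \<open>d\<close> is not \<open>B\<close>-linear,
  \<open>d \<otimes> d\<close> is applied to \<open>\<sigma> \<omega>\<close> before
  \<open>Q\<close> passes to the balanced quotient.\<close>

definition conn_lift :: "'w \<Rightarrow> 'w \<otimes> 'w" where
  "conn_lift \<omega> = tlift (\<lambda>a \<nu>. tlift (\<lambda>b c. d (\<iota> (P (a * S b))) \<otimes> d (\<iota> c)) (\<Delta> (t \<nu>))) (\<Delta>L \<omega>)"

abbreviation Q :: "'w \<otimes> 'w \<Rightarrow> ('w \<otimes> 'w) quot" where "Q \<equiv> qproj (form_rels \<Omega>)"

lemma linear_conn_lift: "clinear conn_lift"
  unfolding conn_lift_def by (simp add: lin_sec)

lemma Q_bal: "\<omega> \<in> \<Omega> 1 \<Longrightarrow> b \<in> \<Omega> 0 \<Longrightarrow> \<nu> \<in> \<Omega> 1 \<Longrightarrow> Q ((\<omega> * b) \<otimes> \<nu>) = Q (\<omega> \<otimes> (b * \<nu>))"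
  unfolding qproj_eq_iff bal_rels_def by (rule cvec.span_base) blast

lemma conn_lift_in: "conn_lift \<omega> \<in> tsub (\<Omega> 1) (\<Omega> 1)"
proof -
  have sub: "csubspace (tsub (\<Omega> 1) (\<Omega> 1))" by (simp add: tsub_def)
  show ?thesis
    unfolding conn_lift_def
  proof (rule tlift_in_subspace[OF sub tsub_UNIV])
    fix a \<nu>
    show "tlift (\<lambda>b c. d (\<iota> (P (a * S b))) \<otimes> d (\<iota> c)) (\<Delta> (t \<nu>)) \<in> tsub (\<Omega> 1) (\<Omega> 1)"
    proof (rule tlift_in_subspace[OF sub coidealB[OF t_B]])
      show "d (\<iota> (P (a * S b))) \<otimes> d (\<iota> c) \<in> tsub (\<Omega> 1) (\<Omega> 1)" if "c \<in> B" for b c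
        unfolding tsub_def using d_\<iota>_in[OF P_in_B] d_\<iota>_in[OF that]
        by (intro cvec.span_base) blast
    qed (simp add: lin_sec)
  qed (simp add: lin_sec)
qed

section \<open>Structure maps on the balanced tensor product, computed on representatives\<close>

lemma form_act_Q: "b \<in> \<Omega> 0 \<Longrightarrow> form_act \<Omega> b (Q s) = Q (tmap ((*) b) id s)"
proof -
  assume b: "b \<in> \<Omega> 0"
  have l: "clinear ((*) b)" "clinear (id :: 'w \<Rightarrow> 'w)" by (simp_all add: clin id_def)
  show ?thesis
    unfolding form_act_def
  proof (rule qmap_qproj[OF clinear_tmap[OF l]])
    fix k assume "k \<in> form_rels \<Omega>"
    then obtain x c y where k: "k = (x * c) \<otimes> y - x \<otimes> (c * y)" "x \<in> \<Omega> 1" "c \<in> \<Omega> 0" "y \<in> \<Omega> 1"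
      unfolding bal_rels_def by blast
    have "tmap ((*) b) id k = (b * x * c) \<otimes> y - (b * x) \<otimes> (c * y)"
      unfolding k(1) by (simp add: cvec_pair.linear_diff[OF clinear_tmap[OF l]] tmap_tens l mult.assoc)
    then show "tmap ((*) b) id k \<in> cspan (form_rels \<Omega>)"
      using k \<Omega>0_mult(1)[OF b k(2)] unfolding bal_rels_def by (intro cvec.span_base) blast
  qed
qed

lemma form_wedge_Q: "form_wedge \<Omega> (Q s) = tlift (*) s"
  unfolding form_wedge_def
proof (rule qlift_qproj[OF clinear_tlift[OF cbilinear_mult]])
  fix k :: "'w \<otimes> 'w" assume "k \<in> form_rels \<Omega>"
  then show "tlift (*) k = 0"
    unfolding bal_rels_def
    by (auto simp: cvec_pair.linear_diff[OF clinear_tlift[OF cbilinear_mult]] tlift_tens[OF cbilinear_mult] mult.assoc)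
qed

text \<open>The formula respects the balancing relations: whether \<open>b\<close> multiplies
  \<open>x\<close> on the right or \<open>y\<close> on the left, \<open>b_1\<close> lands between
  the two coefficients, while \<open>b_2\<close> lies in \<open>B\<close> and can be moved across by
  \<open>Q_bal\<close>.\<close>

lemma form_coaction_Q:
  "form_coaction \<Omega> \<Delta>L (Q s) = tlift (\<lambda>\<omega> \<nu>. tlift (\<lambda>a \<omega>'. tlift (\<lambda>a' \<nu>'. (a * a') \<otimes> Q (\<omega>' \<otimes> \<nu>')) (\<Delta>L \<nu>)) (\<Delta>L \<omega>)) s"
  (is "_ = tlift ?\<Gamma> s")
  unfolding form_coaction_def
proof (rule qlift_qproj)
  have bil: "cbilinear ?\<Gamma>" by (simp add: lin_sec)
  show "clinear (tlift ?\<Gamma>)" by (rule clinear_tlift[OF bil])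
  fix k assume "k \<in> form_rels \<Omega>"
  then obtain x c y where k: "k = (x * c) \<otimes> y - x \<otimes> (c * y)" "x \<in> \<Omega> 1" "c \<in> \<Omega> 0" "y \<in> \<Omega> 1"
    unfolding bal_rels_def by blast
  obtain b where b: "b \<in> B" "c = \<iota> b" using \<Omega>0_cases[OF k(3)] by blast
  have "?\<Gamma> (x * c) y = tlift (\<lambda>a x'. tlift (\<lambda>b1 b2. tlift (\<lambda>a' y'. (a * b1 * a') \<otimes> Q ((x' * \<iota> b2) \<otimes> y')) (\<Delta>L y)) (\<Delta> b)) (\<Delta>L x)"
    by (simp add: swL_mult swL_\<iota> b lin_sec)
  also have "\<dots> = tlift (\<lambda>a x'. tlift (\<lambda>b1 b2. tlift (\<lambda>a' y'. (a * b1 * a') \<otimes> Q (x' \<otimes> (\<iota> b2 * y'))) (\<Delta>L y)) (\<Delta> b)) (\<Delta>L x)"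
  proof (rule tlift_cong_tsub[OF \<Delta>L_\<Omega>1[OF k(2)]])
    fix a x' assume x': "x' \<in> \<Omega> 1"
    show "tlift (\<lambda>b1 b2. tlift (\<lambda>a' y'. (a * b1 * a') \<otimes> Q ((x' * \<iota> b2) \<otimes> y')) (\<Delta>L y)) (\<Delta> b)
       = tlift (\<lambda>b1 b2. tlift (\<lambda>a' y'. (a * b1 * a') \<otimes> Q (x' \<otimes> (\<iota> b2 * y'))) (\<Delta>L y)) (\<Delta> b)"
    proof (rule tlift_cong_tsub[OF coidealB[OF b(1)]])
      fix b1 b2 assume b2: "b2 \<in> B"
      show "tlift (\<lambda>a' y'. (a * b1 * a') \<otimes> Q ((x' * \<iota> b2) \<otimes> y')) (\<Delta>L y)
        = tlift (\<lambda>a' y'. (a * b1 * a') \<otimes> Q (x' \<otimes> (\<iota> b2 * y'))) (\<Delta>L y)"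
        by (rule tlift_cong_tsub[OF \<Delta>L_\<Omega>1[OF k(4)]]) (simp_all add: lin_sec Q_bal x' \<iota>_in b2 del: One_nat_def)
    qed (simp_all add: lin_sec)
  qed (simp_all add: lin_sec)
  also have "\<dots> = ?\<Gamma> x (c * y)"
    by (simp add: swL_mult swL_\<iota> b lin_sec mult.assoc)
  finally show "tlift ?\<Gamma> k = 0"
    unfolding k(1) by (simp add: cvec_pair.linear_diff[OF clinear_tlift[OF bil]] tlift_tens[OF bil] del: One_nat_def)
qed

text \<open>Left \<open>B\<close>-linearity of \<open>\<sigma>\<close>, seen after
  \<open>d \<otimes> d\<close>: in the coaction of \<open>b \<omega>\<close> the map
  \<open>t\<close> turns \<open>b_2\<close> into \<open>\<epsilon>(b_2)\<close>, so all of
  \<open>b\<close> ends up in front of \<open>a\<close>, where \<open>P\<close> lets it out.\<close>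

lemma conn_lift_mult:
  assumes b: "b \<in> B" and \<omega>: "\<omega> \<in> \<Omega> 1"
  shows "conn_lift (\<iota> b * \<omega>) = tlift (\<lambda>a \<nu>. tlift (\<lambda>x c. d (\<iota> b * \<iota> (P (a * S x))) \<otimes> d (\<iota> c)) (\<Delta> (t \<nu>))) (\<Delta>L \<omega>)"
proof -
  let ?G = "\<lambda>a \<nu>. tlift (\<lambda>x c. d (\<iota> (P (a * S x))) \<otimes> d (\<iota> c)) (\<Delta> (t \<nu>))"
  have "conn_lift (\<iota> b * \<omega>) = tlift (\<lambda>b1 b2. tlift (\<lambda>a \<nu>. ?G (b1 * a) (\<iota> b2 * \<nu>)) (\<Delta>L \<omega>)) (\<Delta> b)"
    unfolding conn_lift_def by (simp add: swL_mult swL_\<iota> b lin_sec)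
  also have "\<dots> = tlift (\<lambda>b1 b2. \<epsilon> b2 *\<^sub>C tlift (\<lambda>a \<nu>. ?G (b1 * a) \<nu>) (\<Delta>L \<omega>)) (\<Delta> b)"
  proof (rule tlift_cong_tsub[OF coidealB[OF b]])
    fix b1 b2 assume b2: "b2 \<in> B"
    have "tlift (\<lambda>a \<nu>. ?G (b1 * a) (\<iota> b2 * \<nu>)) (\<Delta>L \<omega>) = tlift (\<lambda>a \<nu>. \<epsilon> b2 *\<^sub>C ?G (b1 * a) \<nu>) (\<Delta>L \<omega>)"
    proof (rule tlift_cong_tsub[OF \<Delta>L_\<Omega>1[OF \<omega>]])
      fix a \<nu> assume \<nu>: "\<nu> \<in> \<Omega> 1"
      have "clinear (\<lambda>v. tlift (\<lambda>x c. d (\<iota> (P (b1 * a * S x))) \<otimes> d (\<iota> c)) (\<Delta> v))" by (simp add: lin_sec)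
      from cvec_pair.linear_scale[OF this] show "?G (b1 * a) (\<iota> b2 * \<nu>) = \<epsilon> b2 *\<^sub>C ?G (b1 * a) \<nu>"
        unfolding t_mult[OF b2 \<nu>] .
    qed (simp_all add: lin_sec)
    then show "tlift (\<lambda>a \<nu>. ?G (b1 * a) (\<iota> b2 * \<nu>)) (\<Delta>L \<omega>) = \<epsilon> b2 *\<^sub>C tlift (\<lambda>a \<nu>. ?G (b1 * a) \<nu>) (\<Delta>L \<omega>)"
      by (simp add: linear_tlift[OF clinear_scaleC_right[OF clinear_ident]])
  qed (simp_all add: lin_sec)
  also have "\<dots> = tlift (\<lambda>a \<nu>. ?G (b * a) \<nu>) (\<Delta>L \<omega>)"
    by (subst sw_counit_right) (simp_all add: lin_sec)
  finally show ?thesis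
    by (simp add: mult.assoc P_mult_left[OF b] \<iota>_mult[OF b P_in_B])
qed

text \<open>Expand \<open>d(b q) = db q + b dq\<close> for \<open>q = P(a S(x))\<close>. In the
  first term balancing turns \<open>db q \<otimes> dc\<close> into \<open>db \<otimes> q dc\<close>,
  whose sum is \<open>db \<otimes> \<omega>\<close> by \<open>section_identity\<close>; the second
  term is \<open>b\<close> acting on the connection.\<close>

lemma conn_lift_Leibniz:
  assumes b: "b \<in> B" and \<omega>: "\<omega> \<in> \<Omega> 1"
  shows "Q (conn_lift (\<iota> b * \<omega>)) = Q (d (\<iota> b) \<otimes> \<omega>) + form_act \<Omega> (\<iota> b) (Q (conn_lift \<omega>))"
proof -
  have lb: "clinear ((*) (\<iota> b))" "clinear (id :: 'w \<Rightarrow> 'w)" by (simp_all add: clin id_def)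
  have "Q (conn_lift (\<iota> b * \<omega>)) = tlift (\<lambda>a \<nu>. tlift (\<lambda>x c. Q (d (\<iota> b * \<iota> (P (a * S x))) \<otimes> d (\<iota> c))) (\<Delta> (t \<nu>))) (\<Delta>L \<omega>)"
    unfolding conn_lift_mult[OF assms] by (simp add: linear_tlift[OF clinear_qproj])
  also have "\<dots> = tlift (\<lambda>a \<nu>. tlift (\<lambda>x c. Q (d (\<iota> b) \<otimes> (\<iota> (P (a * S x)) * d (\<iota> c)))
      + Q ((\<iota> b * d (\<iota> (P (a * S x)))) \<otimes> d (\<iota> c))) (\<Delta> (t \<nu>))) (\<Delta>L \<omega>)"
  proof (rule tlift_cong_tsub[OF tsub_UNIV])
    fix a \<nu>
    show "tlift (\<lambda>x c. Q (d (\<iota> b * \<iota> (P (a * S x))) \<otimes> d (\<iota> c))) (\<Delta> (t \<nu>)) =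
      tlift (\<lambda>x c. Q (d (\<iota> b) \<otimes> (\<iota> (P (a * S x)) * d (\<iota> c)))
      + Q ((\<iota> b * d (\<iota> (P (a * S x)))) \<otimes> d (\<iota> c))) (\<Delta> (t \<nu>))"
    proof (rule tlift_cong_tsub[OF coidealB[OF t_B]])
      fix x c assume c: "c \<in> B"
      show "Q (d (\<iota> b * \<iota> (P (a * S x))) \<otimes> d (\<iota> c)) = Q (d (\<iota> b) \<otimes> (\<iota> (P (a * S x)) * d (\<iota> c)))
      + Q ((\<iota> b * d (\<iota> (P (a * S x)))) \<otimes> d (\<iota> c))"
        unfolding Q_bal[OF d_\<iota>_in[OF b] \<iota>_in[OF P_in_B] d_\<iota>_in[OF c], symmetric] d_mult0[OF \<iota>_in[OF b]]
        by (simp add: cvec_pair.linear_add[OF clinear_qproj] cvec_pair.linear_add[OF clinear_tens_left[OF clinear_ident]])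
    qed (simp_all add: lin_sec)
  qed (simp_all add: lin_sec)
  also have "\<dots> = Q (d (\<iota> b) \<otimes> tlift (\<lambda>a \<nu>. tlift (\<lambda>x c. \<iota> (P (a * S x)) * d (\<iota> c)) (\<Delta> (t \<nu>))) (\<Delta>L \<omega>))
      + Q (tmap ((*) (\<iota> b)) id (conn_lift \<omega>))"
    unfolding conn_lift_def
    by (simp add: tlift_add linear_tlift[OF clinear_qproj] linear_tlift[OF clinear_tens_right[OF clinear_ident]]
       linear_tlift[OF clinear_tmap[OF lb]] tmap_tens lb)
  finally show ?thesis
    by (simp only: section_identity[OF \<omega>] form_act_Q[OF \<iota>_in[OF b]])
qed

lemma conn_lift_torsion_free:
  assumes \<omega>: "\<omega> \<in> \<Omega> 1"
  shows "tlift (*) (conn_lift \<omega>) = d \<omega>"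
proof -
  have "tlift (*) (conn_lift \<omega>) = tlift (\<lambda>a \<nu>. tlift (\<lambda>b c. d (\<iota> (P (a * S b)) * d (\<iota> c))) (\<Delta> (t \<nu>))) (\<Delta>L \<omega>)"
    unfolding conn_lift_def
    by (simp add: linear_tlift[OF clinear_tlift[OF cbilinear_mult]] tlift_tens[OF cbilinear_mult]
      d_mult0[OF \<iota>_in[OF P_in_B]] d_d)
  also have "\<dots> = d (tlift (\<lambda>a \<nu>. tlift (\<lambda>b c. \<iota> (P (a * S b)) * d (\<iota> c)) (\<Delta> (t \<nu>))) (\<Delta>L \<omega>))"
    by (simp add: linear_tlift[OF linear_d])
  finally show ?thesis unfolding section_identity[OF \<omega>] .
qed

text \<open>Colinearity of \<open>P\<close> produces the coefficient \<open>a_1 S(v_2) v_3\<close>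
  for \<open>v = t \<nu>\<close>, in which the legs of \<open>v\<close> cancel. The remaining
  \<open>a_1\<close> is the coefficient of the coaction on \<open>\<omega>\<close>.\<close>

lemma conn_lift_covariant: "form_coaction \<Omega> \<Delta>L (Q (conn_lift \<omega>)) = tmap id (\<lambda>\<omega>. Q (conn_lift \<omega>)) (\<Delta>L \<omega>)"
proof -
  let ?\<Gamma> = "\<lambda>\<omega> \<nu>. tlift (\<lambda>a \<omega>'. tlift (\<lambda>a' \<nu>'. (a * a') \<otimes> Q (\<omega>' \<otimes> \<nu>')) (\<Delta>L \<nu>)) (\<Delta>L \<omega>)"
  have bil: "cbilinear ?\<Gamma>" by (simp add: lin_sec)
  have "form_coaction \<Omega> \<Delta>L (Q (conn_lift \<omega>)) = tlift (\<lambda>a \<nu>. tlift (\<lambda>b c. ?\<Gamma> (d (\<iota> (P (a * S b)))) (d (\<iota> c))) (\<Delta> (t \<nu>))) (\<Delta>L \<omega>)"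
    unfolding form_coaction_Q conn_lift_def by (simp add: linear_tlift[OF clinear_tlift[OF bil]] tlift_tens[OF bil] del: One_nat_def)
  \<comment> \<open>Both factors are differentials of elements of \<open>B\<close>, so their
    coactions come from \<open>\<Delta>\<close>; \<open>sw_P\<close> moves the comultiplication
    inside \<open>P\<close>.\<close>
  also have "\<dots> = tlift (\<lambda>a \<nu>. tlift (\<lambda>b c. tlift (\<lambda>u1 u2. tlift (\<lambda>c1 c2. (u1 * c1) \<otimes> Q (d (\<iota> (P u2)) \<otimes> d (\<iota> c2))) (\<Delta> c)) (\<Delta> (a * S b))) (\<Delta> (t \<nu>))) (\<Delta>L \<omega>)"
  proof (rule tlift_cong_tsub[OF tsub_UNIV])
    fix a \<nu>
    show "tlift (\<lambda>b c. ?\<Gamma> (d (\<iota> (P (a * S b)))) (d (\<iota> c))) (\<Delta> (t \<nu>)) =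
      tlift (\<lambda>b c. tlift (\<lambda>u1 u2. tlift (\<lambda>c1 c2. (u1 * c1) \<otimes> Q (d (\<iota> (P u2)) \<otimes> d (\<iota> c2))) (\<Delta> c)) (\<Delta> (a * S b))) (\<Delta> (t \<nu>))"
      by (rule tlift_cong_tsub[OF coidealB[OF t_B]]) (simp_all add: lin_sec swL_d\<iota> P_in_B sw_P)
  qed (simp_all add: lin_sec)
  \<comment> \<open>The antipode reverses the legs of \<open>b\<close>. Thus \<open>S b2\<close>
    joins the coefficient, directly before \<open>c1\<close>, and \<open>S b1\<close> remains under
    \<open>P\<close>.\<close>
  also have "\<dots> = tlift (\<lambda>a \<nu>. tlift (\<lambda>a1 a2. tlift (\<lambda>b c. tlift (\<lambda>b1 b2. tlift (\<lambda>c1 c2.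
      (a1 * (S b2 * c1)) \<otimes> Q (d (\<iota> (P (a2 * S b1))) \<otimes> d (\<iota> c2))) (\<Delta> c)) (\<Delta> b)) (\<Delta> (t \<nu>))) (\<Delta> a)) (\<Delta>L \<omega>)"
  proof -
    have "tlift (\<lambda>b c. tlift (\<lambda>u1 u2. tlift (\<lambda>c1 c2. (u1 * c1) \<otimes> Q (d (\<iota> (P u2)) \<otimes> d (\<iota> c2))) (\<Delta> c)) (\<Delta> (a * S b))) (\<Delta> v)
      = tlift (\<lambda>b c. tlift (\<lambda>a1 a2. tlift (\<lambda>b1 b2. tlift (\<lambda>c1 c2.
      (a1 * (S b2 * c1)) \<otimes> Q (d (\<iota> (P (a2 * S b1))) \<otimes> d (\<iota> c2))) (\<Delta> c)) (\<Delta> b)) (\<Delta> a)) (\<Delta> v)" for a v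
      by (simp add: sw_mult sw_antipode lin_sec mult.assoc)
    also have "\<dots> a v = tlift (\<lambda>a1 a2. tlift (\<lambda>b c. tlift (\<lambda>b1 b2. tlift (\<lambda>c1 c2.
      (a1 * (S b2 * c1)) \<otimes> Q (d (\<iota> (P (a2 * S b1))) \<otimes> d (\<iota> c2))) (\<Delta> c)) (\<Delta> b)) (\<Delta> v)) (\<Delta> a)" for a v
      by (rule tlift_swap)
    finally show ?thesis by simp
  qed
  also have "\<dots> = tlift (\<lambda>a \<nu>. tlift (\<lambda>a1 a2. tlift (\<lambda>b c. a1 \<otimes> Q (d (\<iota> (P (a2 * S b))) \<otimes> d (\<iota> c))) (\<Delta> (t \<nu>))) (\<Delta> a)) (\<Delta>L \<omega>)"
  proof -
    have "tlift (\<lambda>b c. tlift (\<lambda>b1 b2. tlift (\<lambda>c1 c2.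
      (a1 * (S b2 * c1)) \<otimes> Q (d (\<iota> (P (a2 * S b1))) \<otimes> d (\<iota> c2))) (\<Delta> c)) (\<Delta> b)) (\<Delta> v)
      = tlift (\<lambda>b c. a1 \<otimes> Q (d (\<iota> (P (a2 * S b))) \<otimes> d (\<iota> c))) (\<Delta> v)" (is "?L = ?R") for a1 a2 v
    proof -
      have "?L = tlift (\<lambda>b1 w. tlift (\<lambda>b2 c. tlift (\<lambda>c1 c2.
        (a1 * (S b2 * c1)) \<otimes> Q (d (\<iota> (P (a2 * S b1))) \<otimes> d (\<iota> c2))) (\<Delta> c)) (\<Delta> w)) (\<Delta> v)"
        by (subst sw_coassoc) (simp_all add: lin_sec)
      also have "\<dots> = tlift (\<lambda>b1 w. tlift (\<lambda>u c2. tlift (\<lambda>b2 c1.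
        (a1 * (S b2 * c1)) \<otimes> Q (d (\<iota> (P (a2 * S b1))) \<otimes> d (\<iota> c2))) (\<Delta> u)) (\<Delta> w)) (\<Delta> v)"
        by (simp add: sw_coassoc lin_sec)
      also have "\<dots> = tlift (\<lambda>b1 w. tlift (\<lambda>u c2. \<epsilon> u *\<^sub>C (a1 \<otimes> Q (d (\<iota> (P (a2 * S b1))) \<otimes> d (\<iota> c2)))) (\<Delta> w)) (\<Delta> v)"
        by (subst sw_antipode_left) (simp_all add: lin_sec)
      also have "\<dots> = ?R"
        by (subst sw_counit_left) (simp_all add: lin_sec)
      finally show ?thesis .
    qed
    then show ?thesis by simp
  qed
  \<comment> \<open>Splitting \<open>a\<close> is the same as letting \<open>A\<close> coact once
    more on \<open>\<nu>'\<close>, which reassembles \<open>conn_lift\<close> in the second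
    factor.\<close>
  also have "\<dots> = tlift (\<lambda>a1 \<nu>'. tlift (\<lambda>a2 \<nu>. tlift (\<lambda>b c. a1 \<otimes> Q (d (\<iota> (P (a2 * S b))) \<otimes> d (\<iota> c))) (\<Delta> (t \<nu>))) (\<Delta>L \<nu>')) (\<Delta>L \<omega>)"
    by (subst swL_coassoc) (simp_all add: lin_sec)
  also have "\<dots> = tmap id (\<lambda>\<omega>. Q (conn_lift \<omega>)) (\<Delta>L \<omega>)"
    unfolding tmap_def conn_lift_def
    by (simp add: linear_tlift[OF clinear_qproj] linear_tlift[OF clinear_tens_right[OF clinear_ident]])
  finally show ?thesis .
qed

lemma conn_lift_connection:
  "covariant_connection \<Omega> d \<Delta>L (\<lambda>\<omega>. Q (conn_lift \<omega>))" "torsion_free \<Omega> d (\<lambda>\<omega>. Q (conn_lift \<omega>))"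
proof -
  have "clinear (\<lambda>\<omega>. Q (conn_lift \<omega>))" by (rule clinear_compose2[OF clinear_qproj linear_conn_lift])
  moreover have "Q (conn_lift (b * \<omega>)) = Q (d b \<otimes> \<omega>) + form_act \<Omega> b (Q (conn_lift \<omega>))" if "b \<in> \<Omega> 0" "\<omega> \<in> \<Omega> 1" for b \<omega>
    using that conn_lift_Leibniz \<Omega>0_cases by metis
  ultimately show "covariant_connection \<Omega> d \<Delta>L (\<lambda>\<omega>. Q (conn_lift \<omega>))"
    using conn_lift_in conn_lift_covariant unfolding covariant_connection_def connection_def bal_tensor_def by blast
  show "torsion_free \<Omega> d (\<lambda>\<omega>. Q (conn_lift \<omega>))"
    unfolding torsion_free_def torsion_def form_wedge_Q using conn_lift_torsion_free by simp
qed

end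

theorem proposition4p1:
  fixes \<Delta> :: "'a::complex_algebra_1 \<Rightarrow> 'a \<otimes> 'a"
    and \<epsilon> :: "'a \<Rightarrow> complex"
    and S :: "'a \<Rightarrow> 'a"
    and B :: "'a set"
    and \<iota> :: "'a \<Rightarrow> 'w::complex_algebra_1"
    and \<Omega> :: "nat \<Rightarrow> 'w set"
    and d :: "'w \<Rightarrow> 'w"
    and \<Delta>L :: "'w \<Rightarrow> 'a \<otimes> 'w"
    and star :: "'a \<Rightarrow> 'a"
    and starW :: "'w \<Rightarrow> 'w"
  assumes "hopf_algebra UNIV (*) 1 \<Delta> \<epsilon> S"
    and "quantum_homogeneous_space \<Delta> \<epsilon> B"
    and "cosemisimple_hopf_quotient \<Delta> \<epsilon> B"
    and "\<forall>x y :: 'a. x * y = 0 \<longrightarrow> x = 0 \<or> y = 0"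
    and "covariant_calculus B \<iota> \<Omega> d \<Delta> \<epsilon> \<Delta>L"
    and "star_calculus B \<iota> \<Omega> d star starW"
  shows "\<exists>N. covariant_connection \<Omega> d \<Delta>L N \<and> torsion_free \<Omega> d N"
proof -
  interpret homogeneous_space \<Delta> \<epsilon> S B
    using assms(1,2) by (simp add: homogeneous_space_def sweedler_def homogeneous_space_axioms_def)
  obtain \<chi> where \<chi>: "clinear \<chi>" "\<chi> 1 = 1" "\<forall>x\<in>I. \<chi> x = 0"
    "\<forall>a. tlift (\<lambda>x y. \<chi> y *\<^sub>C x) (\<Delta> a) - \<chi> a *\<^sub>C 1 \<in> I"
    using haar_functional_exists[OF assms(3)] by (elim exE conjE) (rule that)
  interpret haar_homogeneous_space \<Delta> \<epsilon> S B \<chi>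
  proof (intro haar_homogeneous_space.intro haar_homogeneous_space_axioms.intro homogeneous_space_axioms)
    show "clinear \<chi>" by (rule \<chi>(1))
    show "\<chi> 1 = 1" by (rule \<chi>(2))
    show "\<chi> x = 0" if "x \<in> I" for x using \<chi>(3) that by (rule bspec)
    show "tlift (\<lambda>x y. \<chi> y *\<^sub>C x) (\<Delta> a) - \<chi> a *\<^sub>C 1 \<in> I" for a using \<chi>(4) by (rule spec)
  qed
  interpret covariant_calculus B \<iota> \<Omega> d \<Delta> \<epsilon> \<Delta>L by (rule assms(5))
  interpret haar_calculus \<Delta> \<epsilon> S B \<chi> \<iota> \<Omega> d \<Delta>L ..
  obtain t where t: "clinear t" "\<forall>\<omega>. t \<omega> \<in> B" "\<forall>k\<in>K. t k = 0"
    "\<forall>\<omega>\<in>\<Omega> 1. d (\<iota> (t \<omega>)) - \<omega> \<in> K"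
    using fibre_section_exists by (elim exE conjE) (rule that)
  interpret fibre_section \<Delta> \<epsilon> S B \<chi> \<iota> \<Omega> d \<Delta>L t
  proof (intro fibre_section.intro fibre_section_axioms.intro haar_calculus_axioms)
    show "clinear t" by (rule t(1))
    show "t \<omega> \<in> B" for \<omega> using t(2) by (rule spec)
    show "t k = 0" if "k \<in> K" for k using t(3) that by (rule bspec)
    show "d (\<iota> (t \<omega>)) - \<omega> \<in> K" if "\<omega> \<in> \<Omega> 1" for \<omega> using t(4) that by (rule bspec)
  qed
  show ?thesis using conn_lift_connection by blast
qed

end
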